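(* Let $t(n)$ denote the number of partitions $\lambda$ of $n$ such that $\mathcal{O}(\lambda)\equiv\mathcal{O}(\lambda')\pmod 4$, and let $u(n)=p(n)-t(n)$, where $p(n)$ is the number of partitions of $n$. Then, for $|q|<1$, \[ \sum_{n=0}^{\infty}u(n)q^n=\frac{2q^2(q^2;q^2)^2_{\infty}(q^8;q^8)^2_{\infty}(q^{32};q^{32})^2_{\infty}}{(q;q)_{\infty}(q^4;q^4)^5_{\infty}(q^{16};q^{16})_{\infty}}. \]
   Context: For a partition $\lambda$, $\lambda'$ denotes its conjugate partition and $\mathcal{O}(\lambda)$ denotes the number of odd parts of $\lambda$. For $|q|<1$, $(a;q)_\infty=\prod_{k\ge 0}(1-aq^k)$. Equivalently, $u(n)$ is the number of partitions $\lambda$ of $n$ with $\mathcal{O}(\lambda)\not\equiv\mathcal{O}(\lambda')\pmod 4$. *)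

theory Defs
  imports "HOL-Analysis.Analysis"
begin

text \<open>A partition is the list of its (positive) parts in weakly decreasing order.\<close>

definition partitions :: "nat \<Rightarrow> nat list set" where
  "partitions n = {xs. sorted_wrt (\<ge>) xs \<and> 0 \<notin> set xs \<and> sum_list xs = n}"

text \<open>The \<open>i\<close>-th part of the conjugate, for \<open>1 \<le> i \<le> \<lambda>\<^sub>1\<close>, is the number of
  parts of \<open>\<lambda>\<close> that are at least \<open>i\<close>.\<close>

fun conjugate :: "nat list \<Rightarrow> nat list" where
  "conjugate [] = []"
| "conjugate (x # xs) = map (\<lambda>i. length (filter (\<lambda>p. i \<le> p) (x # xs))) [1..<Suc x]"

definition odd_parts :: "nat list \<Rightarrow> nat" where
  "odd_parts xs = length (filter odd xs)"

definition p_count :: "nat \<Rightarrow> nat" where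
  "p_count n = card (partitions n)"

definition t_count :: "nat \<Rightarrow> nat" where
  "t_count n = card {xs \<in> partitions n. odd_parts xs mod 4 = odd_parts (conjugate xs) mod 4}"

definition u_count :: "nat \<Rightarrow> int" where
  "u_count n = int (p_count n) - int (t_count n)"

definition qpochhammer_inf :: "complex \<Rightarrow> complex \<Rightarrow> complex" where
  "qpochhammer_inf a q = (\<Prod>k. 1 - a * q ^ k)"

lemma finite_partitions: "finite (partitions n)"
proof (rule finite_subset)
  have "length xs \<le> sum_list xs" if "0 \<notin> set xs" for xs :: "nat list"
    using that by (induction xs) auto
  moreover have "x \<le> sum_list xs" if "x \<in> set xs" for x and xs :: "nat list"
    using that by (simp add: member_le_sum_list)
  ultimately show "partitions n \<subseteq> {xs. set xs \<subseteq> {..n} \<and> length xs \<le> n}"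
    by (auto simp: partitions_def)
  show "finite {xs. set xs \<subseteq> {..n} \<and> length xs \<le> n}"
    by (rule finite_lists_length_le) simp
qed

end

theory Submission
  imports Defs "HOL-Computational_Algebra.Formal_Power_Series"
begin

text \<open>
  Since \<open>\<O>(\<lambda>)\<close> and \<open>\<O>(\<lambda>')\<close> have the parity of \<open>n\<close>, the sum of \<open>i ^ (\<O>(\<lambda>) - \<O>(\<lambda>'))\<close> over
  the partitions of \<open>n\<close> is \<open>t(n) - u(n) = p(n) - 2 u(n)\<close>, and \<open>\<O>(\<lambda>')\<close> is the alternating
  sum of the parts of \<open>\<lambda>\<close>. Deleting one largest part therefore replaces the weight \<open>y = -i\<close> of
  \<open>\<O>(\<lambda>')\<close> by \<open>1/y\<close>, which gives a linear recurrence for the pair of generating functions with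
  weights \<open>y\<close> and \<open>1/y\<close> of the partitions with parts at most \<open>N\<close>. Up to an explicit product,
  its solution is a Cauchy product of two q-binomial series, and \<open>N \<rightarrow> \<infinity>\<close> yields
  \<open>(-q;q\<^sup>2) / ((q\<^sup>4;q\<^sup>4) (-q\<^sup>2;q\<^sup>4)\<^sup>2)\<close>. The difference of \<open>1/(q;q)\<close> and this product is
  a multiple of \<open>\<phi>(q\<^sup>2) - \<phi>(-q\<^sup>2) = 4 q\<^sup>2 \<psi>(q\<^sup>1\<^sup>6)\<close>, where \<open>\<phi>\<close> and \<open>\<psi>\<close> are
  the theta functions of the squares and of the triangular numbers, whose products come from the Jacobi triple product.
\<close>

section \<open>The q-binomial theorem\<close>

definition qpoch :: "complex \<Rightarrow> complex \<Rightarrow> nat \<Rightarrow> complex" where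
  "qpoch a q n = (\<Prod>k<n. 1 - a * q ^ k)"

lemma qpoch_0 [simp]: "qpoch a q 0 = 1"
  by (simp add: qpoch_def)

lemma qpoch_Suc: "qpoch a q (Suc n) = qpoch a q n * (1 - a * q ^ n)"
  by (simp add: qpoch_def)

lemma norm_power_less_one:
  fixes q :: complex
  assumes "norm q < 1" "0 < n"
  shows "norm (q ^ n) < 1"
  using assms by (simp add: norm_power power_less_one_iff)

lemma power_neq_one:
  fixes q :: complex
  assumes "norm q < 1" "0 < n"
  shows "q ^ n \<noteq> 1"
  using norm_power_less_one[OF assms] by auto

lemma norm_mult_power_less_one:
  fixes a q :: complex
  assumes "norm q < 1" "norm a < 1"
  shows "norm (a * q ^ k) < 1"
proof -
  have "norm (a * q ^ k) = norm a * norm q ^ k"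
    by (simp add: norm_mult norm_power)
  also have "\<dots> \<le> norm a * 1"
    using assms by (intro mult_left_mono power_le_one) auto
  finally show ?thesis using assms by simp
qed

lemma qpoch_nonzero:
  assumes "norm q < 1" "norm a < 1"
  shows "qpoch a q n \<noteq> 0"
proof -
  have "a * q ^ k \<noteq> 1" for k
    using norm_mult_power_less_one[OF assms, of k] by auto
  then show ?thesis
    by (auto simp: qpoch_def)
qed

lemma convergent_prod_qpochhammer:
  fixes a q :: complex
  assumes "norm q < 1"
  shows "convergent_prod (\<lambda>k. 1 - a * q ^ k)"
proof (rule abs_convergent_prod_imp_convergent_prod, subst abs_convergent_prod_conv_summable)
  have "summable (\<lambda>k. norm a * norm q ^ k)"
    using assms by (intro summable_mult summable_geometric) auto
  then show "summable (\<lambda>k. norm (1 - a * q ^ k - 1))"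
    by (simp add: norm_mult norm_power)
qed

lemma qpoch_LIMSEQ:
  assumes "norm q < 1"
  shows "qpoch a q \<longlonglongrightarrow> qpochhammer_inf a q"
proof -
  have "(\<lambda>n. qpoch a q (Suc n)) \<longlonglongrightarrow> qpochhammer_inf a q"
    using convergent_prod_LIMSEQ[OF convergent_prod_qpochhammer[OF assms, of a]]
    by (simp add: qpoch_def qpochhammer_inf_def lessThan_Suc_atMost)
  then show ?thesis by (subst (asm) filterlim_sequentially_Suc)
qed

lemma qpochhammer_inf_nonzero:
  assumes "norm q < 1" "norm a < 1"
  shows "qpochhammer_inf a q \<noteq> 0"
  unfolding qpochhammer_inf_def
proof (rule prodinf_nonzero[OF convergent_prod_qpochhammer[OF assms(1)]])
  show "1 - a * q ^ k \<noteq> 0" for k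
    using norm_mult_power_less_one[OF assms, of k] by auto
qed

lemma qpochhammer_inf_step:
  assumes "norm q < 1"
  shows "qpochhammer_inf a q = (1 - a) * qpochhammer_inf (a * q) q"
proof -
  have "qpoch a q (Suc n) = (1 - a) * qpoch (a * q) q n" for n
    unfolding qpoch_def by (subst prod.lessThan_Suc_shift) (simp add: mult_ac)
  moreover have "(\<lambda>n. qpoch a q (Suc n)) \<longlonglongrightarrow> qpochhammer_inf a q"
    using qpoch_LIMSEQ[OF assms] by (subst filterlim_sequentially_Suc)
  ultimately have "(\<lambda>n. (1 - a) * qpoch (a * q) q n) \<longlonglongrightarrow> qpochhammer_inf a q"
    by simp
  moreover have "(\<lambda>n. (1 - a) * qpoch (a * q) q n) \<longlonglongrightarrow> (1 - a) * qpochhammer_inf (a * q) q"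
    by (intro tendsto_intros qpoch_LIMSEQ assms)
  ultimately show ?thesis by (rule LIMSEQ_unique)
qed

text \<open>The factors with even \<open>k\<close> are separated from those with odd
  \<open>k\<close>; the finite identity with \<open>2 * n\<close> factors then passes to the
  limit.\<close>

lemma qpochhammer_inf_dissect:
  assumes "norm q < 1"
  shows "qpochhammer_inf a q = qpochhammer_inf a (q ^ 2) * qpochhammer_inf (a * q) (q ^ 2)"
proof -
  have q2: "norm (q ^ 2) < 1" using assms by (rule norm_power_less_one) simp
  have "qpoch a q (2 * n) = qpoch a (q ^ 2) n * qpoch (a * q) (q ^ 2) n" for n
    by (induction n) (simp_all add: qpoch_Suc power_mult [symmetric] mult_ac)
  moreover have "(\<lambda>n. qpoch a q (2 * n)) \<longlonglongrightarrow> qpochhammer_inf a q"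
    using LIMSEQ_subseq_LIMSEQ[OF qpoch_LIMSEQ[OF assms, of a], of "\<lambda>n. 2 * n"]
    by (simp add: strict_mono_def o_def)
  ultimately have "(\<lambda>n. qpoch a (q ^ 2) n * qpoch (a * q) (q ^ 2) n) \<longlonglongrightarrow> qpochhammer_inf a q"
    by simp
  moreover have "(\<lambda>n. qpoch a (q ^ 2) n * qpoch (a * q) (q ^ 2) n) \<longlonglongrightarrow>
      qpochhammer_inf a (q ^ 2) * qpochhammer_inf (a * q) (q ^ 2)"
    by (intro tendsto_intros qpoch_LIMSEQ q2)
  ultimately show ?thesis by (rule LIMSEQ_unique)
qed

text \<open>Factor by factor this is (1 - b)(1 + b) = 1 - b^2 with b = a q^k.\<close>

lemma qpochhammer_inf_plus_minus:
  assumes "norm q < 1"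
  shows "qpochhammer_inf a q * qpochhammer_inf (- a) q = qpochhammer_inf (a ^ 2) (q ^ 2)"
proof -
  have q2: "norm (q ^ 2) < 1" using assms by (rule norm_power_less_one) simp
  have "qpoch a q n * qpoch (- a) q n = qpoch (a ^ 2) (q ^ 2) n" for n
    unfolding qpoch_def prod.distrib [symmetric]
    by (intro prod.cong refl) (simp add: algebra_simps power2_eq_square power_mult_distrib)
  moreover have "(\<lambda>n. qpoch a q n * qpoch (- a) q n) \<longlonglongrightarrow>
      qpochhammer_inf a q * qpochhammer_inf (- a) q"
    by (intro tendsto_intros qpoch_LIMSEQ assms)
  ultimately show ?thesis
    using qpoch_LIMSEQ[OF q2, of "a ^ 2"] LIMSEQ_unique by simp
qed

section \<open>The q-binomial series\<close>

definition qbin :: "complex \<Rightarrow> complex \<Rightarrow> nat \<Rightarrow> complex" where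
  "qbin a p k = qpoch a p k / qpoch p p k"

lemma qbin_0 [simp]: "qbin a p 0 = 1"
  by (simp add: qbin_def)

text \<open>The ratio of consecutive coefficients with denominators cleared. The functional
  equations of the q-binomial series below are this relation read coefficientwise.\<close>

lemma qbin_Suc:
  assumes "norm p < 1"
  shows "(1 - p ^ Suc k) * qbin a p (Suc k) = (1 - a * p ^ k) * qbin a p k"
proof -
  have "1 - p ^ Suc k \<noteq> 0" using power_neq_one[OF assms, of "Suc k"] by simp
  then show ?thesis
    using qpoch_nonzero[OF assms assms, of k]
    by (simp add: qbin_def qpoch_Suc field_simps)
qed

lemma qbin_LIMSEQ:
  assumes "norm p < 1"
  shows "qbin a p \<longlonglongrightarrow> qpochhammer_inf a p / qpochhammer_inf p p"
  unfolding qbin_def [abs_def]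
  by (intro tendsto_intros qpoch_LIMSEQ qpochhammer_inf_nonzero assms)

lemma summable_norm_bounded_mult_power:
  fixes c :: "nat \<Rightarrow> complex"
  assumes "Bseq c" "norm u < 1"
  shows "summable (\<lambda>k. norm (c k * u ^ k))"
proof -
  obtain K where K: "\<And>n. norm (c n) \<le> K"
    using assms(1) by (auto simp: Bseq_def)
  show ?thesis
  proof (rule summable_comparison_test')
    show "summable (\<lambda>k. K * norm u ^ k)"
      using assms by (intro summable_mult summable_geometric) auto
    show "norm (norm (c k * u ^ k)) \<le> K * norm u ^ k" for k
      using K by (simp add: norm_mult norm_power mult_right_mono)
  qed
qed

lemma summable_norm_qbin:
  assumes "norm p < 1" "norm u < 1"
  shows "summable (\<lambda>k. norm (qbin a p k * u ^ k))"
  using qbin_LIMSEQ[OF assms(1)] assms(2)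
  by (intro summable_norm_bounded_mult_power convergent_imp_Bseq) (auto simp: convergent_def)

text \<open>The coefficient recurrence gives (1 - v) B(v) = (1 - a v) B(v p). Iterating it n times
  moves the argument to u p^n, which tends to 0, where \<open>B\<close> is continuous with value
  1.\<close>

theorem q_binomial_theorem:
  assumes p: "norm p < 1" and u: "norm u < 1"
  shows "(\<Sum>k. qbin a p k * u ^ k) = qpochhammer_inf (a * u) p / qpochhammer_inf u p"
proof -
  define B where "B v = (\<Sum>k. qbin a p k * v ^ k)" for v
  have summ: "summable (\<lambda>k. qbin a p k * v ^ k)" if "norm v < 1" for v
    by (rule summable_norm_cancel[OF summable_norm_qbin[OF p that]])
  have func: "(1 - v) * B v = (1 - a * v) * B (v * p)" if v: "norm v < 1" for v
  proof -
    have vp: "norm (v * p) < 1"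
      using norm_mult_power_less_one[OF p v, of 1] by simp
    have "(\<lambda>k. qbin a p k * v ^ k - qbin a p k * (v * p) ^ k) sums (B v - B (v * p))"
      unfolding B_def by (intro sums_diff summable_sums summ v vp)
    \<comment> \<open>The term k = 0 of the difference vanishes, so the index can be shifted without
      changing the sum.\<close>
    then have "(\<lambda>k. qbin a p (Suc k) * v ^ Suc k - qbin a p (Suc k) * (v * p) ^ Suc k)
        sums (B v - B (v * p))"
      by (subst sums_Suc_iff) simp
    moreover have "qbin a p (Suc k) * v ^ Suc k - qbin a p (Suc k) * (v * p) ^ Suc k =
        v * (qbin a p k * v ^ k) - a * v * (qbin a p k * (v * p) ^ k)" for k
    proof -
      have "qbin a p (Suc k) * v ^ Suc k - qbin a p (Suc k) * (v * p) ^ Suc k =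
          v ^ Suc k * ((1 - p ^ Suc k) * qbin a p (Suc k))"
        by (simp add: algebra_simps power_mult_distrib)
      also have "\<dots> = v ^ Suc k * ((1 - a * p ^ k) * qbin a p k)"
        by (simp only: qbin_Suc[OF p])
      finally show ?thesis by (simp add: algebra_simps power_mult_distrib)
    qed
    moreover have "(\<lambda>k. v * (qbin a p k * v ^ k) - a * v * (qbin a p k * (v * p) ^ k))
        sums (v * B v - a * v * B (v * p))"
      unfolding B_def by (intro sums_diff sums_mult summable_sums summ v vp)
    ultimately have "B v - B (v * p) = v * B v - a * v * B (v * p)"
      by (simp add: sums_unique2)
    then show ?thesis by (simp add: algebra_simps)
  qed
  have iter: "qpoch u p n * B u = qpoch (a * u) p n * B (u * p ^ n)" for n
  proof (induction n)
    case (Suc n)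
    have "qpoch u p (Suc n) * B u = (1 - u * p ^ n) * (qpoch u p n * B u)"
      by (simp add: qpoch_Suc)
    also have "\<dots> = qpoch (a * u) p n * ((1 - u * p ^ n) * B (u * p ^ n))"
      by (simp add: Suc.IH)
    also have "\<dots> = qpoch (a * u) p (Suc n) * B (u * p ^ Suc n)"
      using func[of "u * p ^ n"] norm_mult_power_less_one[OF p u, of n]
      by (simp add: qpoch_Suc mult_ac)
    finally show ?case .
  qed simp
  have "B \<midarrow>0\<rightarrow> qbin a p 0"
    unfolding B_def using summ by (intro powser_limit_0[of 1]) (auto simp: summable_sums)
  then have "isCont B 0"
    by (simp add: isCont_def B_def)
  moreover have "(\<lambda>n. u * p ^ n) \<longlonglongrightarrow> u * 0"
    by (intro tendsto_intros LIMSEQ_power_zero p)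
  ultimately have "(\<lambda>n. B (u * p ^ n)) \<longlonglongrightarrow> B 0"
    using isCont_tendsto_compose by fastforce
  moreover have "B 0 = 1" by (simp add: B_def)
  ultimately have "(\<lambda>n. qpoch (a * u) p n * B (u * p ^ n)) \<longlonglongrightarrow> qpochhammer_inf (a * u) p * 1"
    by (intro tendsto_intros qpoch_LIMSEQ p) simp
  moreover have "(\<lambda>n. qpoch u p n * B u) \<longlonglongrightarrow> qpochhammer_inf u p * B u"
    by (intro tendsto_intros qpoch_LIMSEQ p)
  ultimately have "qpochhammer_inf u p * B u = qpochhammer_inf (a * u) p"
    using iter LIMSEQ_unique by simp
  then show ?thesis
    using qpochhammer_inf_nonzero[OF p u] by (simp add: B_def field_simps)
qed

section \<open>Formal power series and the convolution of two q-binomial series\<close>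

definition fps_scale :: "complex \<Rightarrow> complex fps \<Rightarrow> complex fps" where
  "fps_scale c f = Abs_fps (\<lambda>n. c ^ n * fps_nth f n)"

lemma fps_scale_nth [simp]: "fps_nth (fps_scale c f) n = c ^ n * fps_nth f n"
  by (simp add: fps_scale_def)

text \<open>\<open>fps_scale c f\<close> is the series f(cX), and this substitution respects
  products because c^n = c^i c^(n-i).\<close>

lemma fps_scale_mult: "fps_scale c (f * g) = fps_scale c f * fps_scale c g"
proof (rule fps_ext)
  fix n
  have "c ^ n * (fps_nth f i * fps_nth g (n - i)) =
      c ^ i * fps_nth f i * (c ^ (n - i) * fps_nth g (n - i))" if "i \<in> {0..n}" for i
  proof -
    have "c ^ n = c ^ i * c ^ (n - i)"
      using that by (simp flip: power_add)
    then show ?thesis by simp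
  qed
  then show "fps_nth (fps_scale c (f * g)) n = fps_nth (fps_scale c f * fps_scale c g) n"
    unfolding fps_mult_nth fps_scale_nth sum_distrib_left by (intro sum.cong refl)
qed

lemma fps_scale_scale [simp]: "fps_scale c (fps_scale d f) = fps_scale (c * d) f"
  by (rule fps_ext) (simp add: power_mult_distrib)

lemma fps_scale_linear [simp]:
  "fps_scale c (1 - fps_const a * fps_X) = 1 - fps_const (c * a) * fps_X"
  by (rule fps_ext) (simp add: fps_X_def)

abbreviation qbin_fps :: "complex \<Rightarrow> complex \<Rightarrow> complex fps" where
  "qbin_fps a p \<equiv> Abs_fps (qbin a p)"

text \<open>The formal counterpart of (1 - v) B(v) = (1 - a v) B(v p). The constant 1 is written out
  so that both linear factors have the shape of \<open>fps_scale_linear\<close>.\<close>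

lemma qbin_fps_functional_equation:
  assumes "norm p < 1"
  shows "(1 - fps_const 1 * fps_X) * qbin_fps a p =
    (1 - fps_const a * fps_X) * fps_scale p (qbin_fps a p)"
proof (rule fps_ext)
  fix n
  show "fps_nth ((1 - fps_const 1 * fps_X) * qbin_fps a p) n =
      fps_nth ((1 - fps_const a * fps_X) * fps_scale p (qbin_fps a p)) n"
  proof (cases n)
    case (Suc k)
    then show ?thesis
      using qbin_Suc[OF assms, of k a] by (simp add: left_diff_distrib mult.assoc algebra_simps)
  qed (simp add: left_diff_distrib mult.assoc)
qed

text \<open>The specialisation \<open>z = i\<close>, \<open>y = -i\<close> of the q-binomial sum in Andrews' finite form of the
  generating function of the statistics \<open>\<O>(\<lambda>)\<close> and \<open>\<O>(\<lambda>')\<close>.\<close>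

definition qbin_conv :: "complex \<Rightarrow> nat \<Rightarrow> complex" where
  "qbin_conv q m = (\<Sum>k\<le>m. qbin (- q) (q ^ 4) k * (qbin q (q ^ 4) (m - k) * (- (q ^ 2)) ^ (m - k)))"

lemma qbin_conv_0 [simp]: "qbin_conv q 0 = 1"
  by (simp add: qbin_conv_def)

lemma Abs_fps_qbin_conv:
  "Abs_fps (qbin_conv q) = qbin_fps (- q) (q ^ 4) * fps_scale (- (q ^ 2)) (qbin_fps q (q ^ 4))"
  by (rule fps_ext) (simp add: qbin_conv_def fps_mult_nth atMost_atLeast0 mult_ac)

text \<open>The generating function of \<open>qbin_conv q\<close> is F(X) = A(X) B(tX) with t = -q^2
  and t^2 = p = q^4. The functional equations of A and B express (1 - X) F(X) through F(pX) and
  H(tX), where H belongs to -q; the coefficients of X^(m+1) give the recurrence.\<close>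

lemma qbin_conv_Suc:
  assumes "norm q < 1"
  shows "(1 - q ^ (4 * Suc m)) * qbin_conv q (Suc m) =
    (1 + q ^ (4 * m + 3)) * qbin_conv q m +
    q * (1 - q) * (- (q ^ 2)) ^ m * qbin_conv (- q) m"
proof -
  define p where "p = q ^ 4"
  define t where "t = - (q ^ 2)"
  define F where "F = Abs_fps (qbin_conv q)"
  define H where "H = Abs_fps (qbin_conv (- q))"
  define A where "A = qbin_fps (- q) p"
  define B where "B = qbin_fps q p"
  have p: "norm p < 1"
    unfolding p_def using assms by (rule norm_power_less_one) simp
  have tt: "t * t = p"
    by (simp add: t_def p_def flip: power_add)
  have F: "F = A * fps_scale t B"
    by (simp add: F_def A_def B_def p_def t_def Abs_fps_qbin_conv)
  \<comment> \<open>Replacing q by -q exchanges \<open>A\<close> and \<open>B\<close> and fixes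
    \<open>p\<close> and \<open>t\<close>.\<close>
  have H: "H = B * fps_scale t A"
    by (simp add: H_def A_def B_def p_def t_def Abs_fps_qbin_conv)
  have A: "(1 - fps_X) * A = (1 + fps_const q * fps_X) * fps_scale p A"
    using qbin_fps_functional_equation[OF p, of "- q"]
    by (simp add: A_def flip: fps_const_neg)
  have B: "(1 - fps_const t * fps_X) * fps_scale t B =
      (1 - fps_const (t * q) * fps_X) * fps_scale (t * p) B"
    using arg_cong[OF qbin_fps_functional_equation[OF p, of q], of "fps_scale t"]
    unfolding fps_scale_mult by (simp add: B_def fps_scale_linear[of t 1, simplified])
  have tq: "fps_const t = - (fps_const q * fps_const q)"
    by (simp add: t_def power2_eq_square)
  have qq: "fps_const (q * (1 - q)) = fps_const q * (1 - fps_const q)"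
    by (simp add: right_diff_distrib flip: fps_const_mult fps_const_sub)
  have Fp: "fps_scale p F = fps_scale p A * fps_scale (t * p) B"
    by (simp add: F fps_scale_mult mult.commute)
  have Ht: "fps_scale t H = fps_scale t B * fps_scale p A"
    by (simp add: H fps_scale_mult tt)
  have "(1 - fps_X) * F = ((1 - fps_X) * A) * fps_scale t B"
    by (simp add: F mult.assoc)
  \<comment> \<open>The factor 1 + qX is split as (1 - tX) + q(1 - q)X: the first summand fits the
    equation \<open>B\<close>, the second yields \<open>H\<close>.\<close>
  also have "\<dots> = fps_scale p A * ((1 - fps_const t * fps_X) * fps_scale t B)
      + fps_const q * (1 - fps_const q) * fps_X * (fps_scale t B * fps_scale p A)"
    unfolding A tq
    by (simp add: algebra_simps del: fps_const_mult fps_const_neg fps_const_sub)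
  also have "\<dots> = (1 - fps_const (t * q) * fps_X) * fps_scale p F
      + fps_const (q * (1 - q)) * fps_X * fps_scale t H"
    unfolding B Fp Ht qq by (simp only: mult_ac)
  finally have eq: "(1 - fps_X) * F = (1 - fps_const (t * q) * fps_X) * fps_scale p F
      + fps_const (q * (1 - q)) * fps_X * fps_scale t H" .
  have "fps_nth ((1 - fps_X) * F) (Suc m) = fps_nth ((1 - fps_const (t * q) * fps_X) * fps_scale p F
      + fps_const (q * (1 - q)) * fps_X * fps_scale t H) (Suc m)"
    by (simp only: eq)
  then have "qbin_conv q (Suc m) - qbin_conv q m =
      p ^ Suc m * qbin_conv q (Suc m) - t * q * p ^ m * qbin_conv q m
      + q * (1 - q) * t ^ m * qbin_conv (- q) m"
    by (simp add: F_def H_def left_diff_distrib mult.assoc del: power_Suc)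
  moreover have "p ^ Suc m = q ^ (4 * Suc m)" "t * q * p ^ m = - (q ^ (4 * m + 3))"
    by (simp_all add: p_def t_def power_mult power_add power2_eq_square power3_eq_cube)
  ultimately have "qbin_conv q (Suc m) - qbin_conv q m =
      q ^ (4 * Suc m) * qbin_conv q (Suc m) + q ^ (4 * m + 3) * qbin_conv q m
      + q * (1 - q) * t ^ m * qbin_conv (- q) m"
    by (simp only: diff_minus_eq_add mult_minus_left)
  then show ?thesis
    by (simp only: t_def algebra_simps mult_1_left)
qed

text \<open>In the convolution the first factor \<open>A\<close> only converges, so its differences
  \<open>c\<close> take its place. Their sum is the limit of \<open>A\<close>, and the partial sums
  of the Cauchy product of \<open>c\<close> and \<open>b\<close> are exactly
  \<open>qbin_conv q\<close>; the limit is thus (lim A) times the sum of \<open>b\<close>, which the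
  q-binomial theorem evaluates.\<close>

lemma qbin_conv_LIMSEQ:
  assumes q: "norm q < 1"
  shows "qbin_conv q \<longlonglongrightarrow>
    qpochhammer_inf (- q) (q ^ 4) / qpochhammer_inf (q ^ 4) (q ^ 4) *
    (qpochhammer_inf (- (q ^ 3)) (q ^ 4) / qpochhammer_inf (- (q ^ 2)) (q ^ 4))"
proof -
  define p where "p = q ^ 4"
  define t where "t = - (q ^ 2)"
  have p: "norm p < 1"
    unfolding p_def using assms by (rule norm_power_less_one) simp
  have t: "norm t < 1"
    unfolding t_def using norm_power_less_one[OF q, of 2] by simp
  define A where "A = qbin (- q) p"
  define b where "b k = qbin q p k * t ^ k" for k
  define c where "c k = (if k = 0 then 1 else A k - A (k - 1))" for k
  have sum_c: "(\<Sum>k\<le>n. c k) = A n" for n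
    by (induction n) (auto simp: c_def A_def)
  have A_lim: "A \<longlonglongrightarrow> qpochhammer_inf (- q) p / qpochhammer_inf p p"
    unfolding A_def by (rule qbin_LIMSEQ[OF p])
  have c_sums: "c sums (qpochhammer_inf (- q) p / qpochhammer_inf p p)"
    unfolding sums_def_le sum_c using A_lim .
  have "summable (\<lambda>k. norm (c k))"
  proof -
    have Bs: "Bseq A"
      using A_lim by (intro convergent_imp_Bseq) (auto simp: convergent_def)
    have "summable (\<lambda>k. norm (A (Suc k) * p ^ Suc k) + norm q * norm (A k * p ^ k))"
      by (intro summable_add summable_mult summable_norm_bounded_mult_power Bs p
          iffD2[OF summable_Suc_iff[of "\<lambda>k. norm (A k * p ^ k)"]])
    then have "summable (\<lambda>k. norm (c (Suc k)))"
    proof (rule summable_comparison_test')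
      fix k
      \<comment> \<open>The recurrence of the coefficients makes the differences geometrically
        small, as \<open>A\<close> is bounded.\<close>
      have "c (Suc k) = A (Suc k) * p ^ Suc k + q * (A k * p ^ k)"
        using qbin_Suc[OF p, of k "- q"] by (simp add: c_def A_def algebra_simps)
      then show "norm (norm (c (Suc k))) \<le> norm (A (Suc k) * p ^ Suc k) + norm q * norm (A k * p ^ k)"
        using norm_triangle_ineq[of "A (Suc k) * p ^ Suc k" "q * (A k * p ^ k)"]
        by (simp add: norm_mult)
    qed
    then show ?thesis by (simp only: summable_Suc_iff[of "\<lambda>k. norm (c k)"])
  qed
  moreover have "summable (\<lambda>k. norm (b k))"
    unfolding b_def by (rule summable_norm_qbin[OF p t])
  ultimately have "(\<lambda>m. \<Sum>k\<le>m. c k * b (m - k)) sums (suminf c * suminf b)"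
    by (rule Cauchy_product_sums)
  then have "(\<lambda>n. \<Sum>m\<le>n. \<Sum>k\<le>m. c k * b (m - k)) \<longlonglongrightarrow> suminf c * suminf b"
    by (simp add: sums_def_le)
  \<comment> \<open>Summation by parts: the m-th term of the Cauchy product is the difference of
    consecutive values of \<open>qbin_conv q\<close>.\<close>
  moreover have "(\<Sum>m\<le>n. \<Sum>k\<le>m. c k * b (m - k)) = qbin_conv q n" for n
  proof (induction n)
    case (Suc n)
    have "(\<Sum>k\<le>Suc n. c k * b (Suc n - k)) = b (Suc n) + (\<Sum>k\<le>n. c (Suc k) * b (n - k))"
      by (subst sum.atMost_Suc_shift) (simp add: c_def)
    also have "\<dots> = b (Suc n) + (\<Sum>k\<le>n. A (Suc k) * b (n - k)) - (\<Sum>k\<le>n. A k * b (n - k))"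
      by (simp add: c_def left_diff_distrib sum_subtractf)
    also have "b (Suc n) + (\<Sum>k\<le>n. A (Suc k) * b (n - k)) = (\<Sum>k\<le>Suc n. A k * b (Suc n - k))"
      using sum.atMost_Suc_shift[of "\<lambda>k. A k * b (Suc n - k)" n] by (simp add: A_def)
    also have "\<dots> = qbin_conv q (Suc n)"
      by (simp add: qbin_conv_def A_def b_def p_def t_def)
    also have "(\<Sum>k\<le>n. A k * b (n - k)) = qbin_conv q n"
      by (simp add: qbin_conv_def A_def b_def p_def t_def)
    finally show ?case using Suc.IH by simp
  qed (simp add: c_def b_def)
  moreover have "suminf b = qpochhammer_inf (q * t) p / qpochhammer_inf t p"
    unfolding b_def by (rule q_binomial_theorem[OF p t])
  moreover have "q * t = - (q ^ 3)"
    by (simp add: t_def power2_eq_square power3_eq_cube)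
  ultimately show ?thesis
    using sums_unique[OF c_sums] by (simp add: p_def t_def)
qed

section \<open>The Jacobi triple product\<close>

text \<open>The value 0 for \<open>k > n\<close> keeps the Pascal rules valid at the edge
  \<open>k = n\<close> and lets sums over \<open>k\<close> be extended by one index.\<close>

definition gauss_binomial :: "complex \<Rightarrow> nat \<Rightarrow> nat \<Rightarrow> complex" where
  "gauss_binomial p n k = (if k \<le> n then qpoch p p n / (qpoch p p k * qpoch p p (n - k)) else 0)"

context
  fixes p :: complex
  assumes p: "norm p < 1"
begin

text \<open>For n = k + d + 1, a = p^(k+1) and b = p^(d+1), a common denominator reduces the two
  rules to the splittings 1 - ab = (1 - a) + a(1 - b) and 1 - ab = b(1 - a) + (1 - b).\<close>

lemma gauss_binomial_Suc_Suc:
  shows "gauss_binomial p (Suc n) (Suc k) = gauss_binomial p n k + p ^ Suc k * gauss_binomial p n (Suc k)"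
    and "gauss_binomial p (Suc n) (Suc k) = p ^ (n - k) * gauss_binomial p n k + gauss_binomial p n (Suc k)"
proof -
  have nz: "qpoch p p j \<noteq> 0" for j
    using qpoch_nonzero[OF p p] .
  have one: "1 - p ^ Suc j \<noteq> 0" for j
    using power_neq_one[OF p, of "Suc j"] by simp
  have Suc: "qpoch p p (Suc j) = qpoch p p j * (1 - p ^ Suc j)" for j
    by (simp add: qpoch_Suc)
  consider "k < n" | "k = n" | "k > n" by linarith
  then have "gauss_binomial p (Suc n) (Suc k) = gauss_binomial p n k + p ^ Suc k * gauss_binomial p n (Suc k)
    \<and> gauss_binomial p (Suc n) (Suc k) = p ^ (n - k) * gauss_binomial p n k + gauss_binomial p n (Suc k)"
  proof cases
    case 1
    then obtain d where d: "n = Suc (k + d)"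
      using less_imp_Suc_add by blast
    have A: "gauss_binomial p n k = qpoch p p n / (qpoch p p k * qpoch p p d * (1 - p ^ Suc d))"
      by (simp add: gauss_binomial_def d Suc del: power_Suc)
    have B: "gauss_binomial p n (Suc k) = qpoch p p n / (qpoch p p k * qpoch p p d * (1 - p ^ Suc k))"
      by (simp add: gauss_binomial_def d Suc del: power_Suc)
    have C: "gauss_binomial p (Suc n) (Suc k) = qpoch p p n * (1 - p ^ Suc k * p ^ Suc d) /
        (qpoch p p k * qpoch p p d * (1 - p ^ Suc k) * (1 - p ^ Suc d))"
    proof -
      have "p ^ Suc n = p ^ Suc k * p ^ Suc d" by (simp add: d power_add)
      moreover have "Suc n - Suc k = Suc d" "Suc k \<le> Suc n" by (simp_all add: d)
      ultimately show ?thesis by (simp add: gauss_binomial_def Suc mult_ac del: power_Suc)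
    qed
    have nk: "p ^ (n - k) = p ^ Suc d" by (simp add: d)
    have aux: "1 - a \<noteq> 0 \<Longrightarrow> 1 - b \<noteq> 0 \<Longrightarrow> u \<noteq> 0 \<Longrightarrow> v \<noteq> 0 \<Longrightarrow>
        w * (1 - a * b) / (u * v * (1 - a) * (1 - b)) =
          w / (u * v * (1 - b)) + a * (w / (u * v * (1 - a))) \<and>
        w * (1 - a * b) / (u * v * (1 - a) * (1 - b)) =
          b * (w / (u * v * (1 - b))) + w / (u * v * (1 - a))"
      for a b u v w :: complex
      by (simp add: divide_simps) (simp add: algebra_simps)
    show ?thesis
      unfolding A B C nk by (rule aux) (use one nz in auto)
  qed (auto simp: gauss_binomial_def nz)
  then show "gauss_binomial p (Suc n) (Suc k) = gauss_binomial p n k + p ^ Suc k * gauss_binomial p n (Suc k)"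
    and "gauss_binomial p (Suc n) (Suc k) = p ^ (n - k) * gauss_binomial p n k + gauss_binomial p n (Suc k)"
    by auto
qed

lemma gauss_binomial_n_0 [simp]: "gauss_binomial p n 0 = 1"
  using qpoch_nonzero[OF p p] by (simp add: gauss_binomial_def)

end

lemma gauss_binomial_eq_0 [simp]: "n < k \<Longrightarrow> gauss_binomial p n k = 0"
  by (simp add: gauss_binomial_def)

text \<open>Finite form of the Jacobi triple product with its negative powers cleared; unequal \<open>M\<close> and \<open>N\<close>
  make it provable by one q-Pascal rule per induction.\<close>

lemma prod_eq_sum_gauss_binomial:
  assumes q: "norm q < 1"
  shows "(\<Prod>k<M. z + q ^ (2 * k + 1)) * (\<Prod>k<N. 1 + z * q ^ (2 * k + 1)) =
    (\<Sum>j\<le>M + N. gauss_binomial (q ^ 2) (M + N) j * q ^ nat ((int M - int j) ^ 2) * z ^ j)"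
proof -
  define G where "G = gauss_binomial (q ^ 2)"
  define e where "e M j = nat ((int M - int j) ^ 2)" for M j
  have p: "norm (q ^ 2) < 1"
    using q by (rule norm_power_less_one) simp
  have e_int: "int (e M j) = (int M - int j) ^ 2" for M j
    by (simp add: e_def)
  note pascal = gauss_binomial_Suc_Suc[OF p, folded G_def]
  have G0: "G n 0 = 1" for n
    unfolding G_def using gauss_binomial_n_0[OF p] .
  have Gbig: "G n (Suc n) = 0" for n
    by (simp add: G_def)
  have base: "(\<Prod>k<M. z + q ^ (2 * k + 1)) = (\<Sum>j\<le>M. G M j * q ^ e M j * z ^ j)" for M
  proof (induction M)
    case (Suc M)
    let ?f = "\<lambda>j. G M j * q ^ e M j * z ^ j"
    have e1: "e (Suc M) (Suc j) = e M j" for j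
      by (simp add: e_def)
    \<comment> \<open>The surplus 2(j + 1) in the exponent is the power of q^2 that the first Pascal
      rule demands.\<close>
    have e2: "e M (Suc j) + (2 * M + 1) = e M j + 2 * Suc j" for j
      unfolding of_nat_eq_iff [where 'a = int, symmetric]
      by (simp add: e_int power2_eq_square algebra_simps)
    have e3: "e (Suc M) 0 = e M 0 + (2 * M + 1)"
      unfolding of_nat_eq_iff [where 'a = int, symmetric]
      by (simp add: e_int power2_eq_square algebra_simps)
    have step: "G (Suc M) (Suc j) * q ^ e (Suc M) (Suc j) * z ^ Suc j =
        z * ?f j + q ^ (2 * M + 1) * ?f (Suc j)" for j
    proof -
      have "q ^ (2 * M + 1) * ?f (Suc j) = G M (Suc j) * q ^ (e M (Suc j) + (2 * M + 1)) * z ^ Suc j"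
        by (simp only: power_add mult_ac)
      also have "\<dots> = (q ^ 2) ^ Suc j * G M (Suc j) * q ^ e M j * z ^ Suc j"
        unfolding e2 power_add power_mult by (simp only: mult_ac)
      finally have *: "q ^ (2 * M + 1) * ?f (Suc j) =
          (q ^ 2) ^ Suc j * G M (Suc j) * q ^ e M j * z ^ Suc j" .
      show ?thesis
        unfolding e1 pascal(1) * by (simp only: distrib_right distrib_left power_Suc[of z] mult_ac)
    qed
    have "(\<Sum>j\<le>Suc M. G (Suc M) j * q ^ e (Suc M) j * z ^ j) =
        q ^ (2 * M + 1) * ?f 0 + (\<Sum>j\<le>M. z * ?f j + q ^ (2 * M + 1) * ?f (Suc j))"
      unfolding step [symmetric] sum.atMost_Suc_shift
      by (simp add: G0 e3 power_add)
    also have "\<dots> = z * (\<Sum>j\<le>M. ?f j) + q ^ (2 * M + 1) * (?f 0 + (\<Sum>j\<le>M. ?f (Suc j)))"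
      by (simp only: sum.distrib sum_distrib_left ring_distribs add_ac)
    also have "?f 0 + (\<Sum>j\<le>M. ?f (Suc j)) = (\<Sum>j\<le>Suc M. ?f j)"
      by (simp only: sum.atMost_Suc_shift)
    also have "\<dots> = (\<Sum>j\<le>M. ?f j)" by (simp add: Gbig)
    finally show ?case using Suc.IH by (simp add: algebra_simps)
  qed (simp add: G0 e_def)
  have "(\<Prod>k<M. z + q ^ (2 * k + 1)) * (\<Prod>k<N. 1 + z * q ^ (2 * k + 1)) =
      (\<Sum>j\<le>M + N. G (M + N) j * q ^ e M j * z ^ j)"
  proof (induction N)
    case (Suc N)
    let ?f = "\<lambda>j. G (M + N) j * q ^ e M j * z ^ j"
    \<comment> \<open>Here the surplus 2(M + N - j) is the power of q^2 in the second Pascal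
      rule.\<close>
    have e2: "e M j + (2 * N + 1) = e M (Suc j) + 2 * (M + N - j)" if "j \<le> M + N" for j
      unfolding of_nat_eq_iff [where 'a = int, symmetric]
      using that by (simp add: e_int power2_eq_square algebra_simps of_nat_diff)
    have step: "G (Suc (M + N)) (Suc j) * q ^ e M (Suc j) * z ^ Suc j =
        z * q ^ (2 * N + 1) * ?f j + ?f (Suc j)" if "j \<le> M + N" for j
    proof -
      have "z * q ^ (2 * N + 1) * ?f j = G (M + N) j * q ^ (e M j + (2 * N + 1)) * z ^ Suc j"
        by (simp only: power_add power_Suc mult_ac)
      also have "\<dots> = (q ^ 2) ^ (M + N - j) * G (M + N) j * q ^ e M (Suc j) * z ^ Suc j"
        unfolding e2[OF that] power_add power_mult by (simp only: mult_ac)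
      finally have *: "z * q ^ (2 * N + 1) * ?f j =
          (q ^ 2) ^ (M + N - j) * G (M + N) j * q ^ e M (Suc j) * z ^ Suc j" .
      show ?thesis
        unfolding pascal(2) * by (simp only: distrib_right distrib_left power_Suc[of z] mult_ac)
    qed
    have "(\<Sum>j\<le>Suc (M + N). G (Suc (M + N)) j * q ^ e M j * z ^ j) =
        ?f 0 + (\<Sum>j\<le>M + N. G (Suc (M + N)) (Suc j) * q ^ e M (Suc j) * z ^ Suc j)"
      unfolding sum.atMost_Suc_shift by (simp add: G0)
    also have "\<dots> = ?f 0 + (\<Sum>j\<le>M + N. z * q ^ (2 * N + 1) * ?f j + ?f (Suc j))"
      using step by (intro arg_cong2[of _ _ _ _ "(+)"] sum.cong refl) auto
    also have "\<dots> = z * q ^ (2 * N + 1) * (\<Sum>j\<le>M + N. ?f j) + (?f 0 + (\<Sum>j\<le>M + N. ?f (Suc j)))"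
      by (simp only: sum.distrib sum_distrib_left add_ac)
    also have "?f 0 + (\<Sum>j\<le>M + N. ?f (Suc j)) = (\<Sum>j\<le>Suc (M + N). ?f j)"
      by (simp only: sum.atMost_Suc_shift)
    also have "\<dots> = (\<Sum>j\<le>M + N. ?f j)" by (simp add: Gbig)
    finally show ?case using Suc.IH by (simp add: algebra_simps)
  qed (simp only: lessThan_0 prod.empty mult_1_right Nat.add_0_right base)
  then show ?thesis by (simp add: G_def e_def)
qed

text \<open>The norm of the m-th term is (|q|^m |z|)^m, whose base is eventually below 1/2.\<close>

lemma summable_norm_theta:
  fixes q z :: complex
  assumes q: "norm q < 1"
  shows "summable (\<lambda>m. norm (q ^ (m ^ 2) * z ^ m))"
proof (rule summable_comparison_test_ev)
  have "(\<lambda>m. norm q ^ m * norm z) \<longlonglongrightarrow> 0 * norm z"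
    using q by (intro tendsto_intros LIMSEQ_power_zero) auto
  then have "\<forall>\<^sub>F m in sequentially. norm q ^ m * norm z < 1 / 2"
    by (rule order_tendstoD) simp
  then show "\<forall>\<^sub>F m in sequentially. norm (norm (q ^ (m ^ 2) * z ^ m)) \<le> (1 / 2) ^ m"
  proof eventually_elim
    case (elim m)
    have "norm (norm (q ^ (m ^ 2) * z ^ m)) = (norm q ^ m * norm z) ^ m"
      by (simp add: norm_mult norm_power power_mult_distrib power2_eq_square power_mult)
    also have "\<dots> \<le> (1 / 2) ^ m"
      using elim by (intro power_mono) auto
    finally show ?case .
  qed
qed (auto intro: summable_geometric)

text \<open>The finite form with M = N = n is divided by z^n and its index is centred at n. The
  Gaussian binomials are bounded and tend to 1/(q^2;q^2), so Tannery's theorem gives the limit; the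
  two series carry the exponents of z that are nonnegative and negative.\<close>

theorem jacobi_triple_product:
  assumes q: "norm q < 1" and z: "z \<noteq> 0"
  shows "(\<Sum>m. q ^ (m ^ 2) * z ^ m) + (\<Sum>m. q ^ (Suc m ^ 2) * inverse z ^ Suc m) =
    qpochhammer_inf (- (z * q)) (q ^ 2) * qpochhammer_inf (- (inverse z * q)) (q ^ 2) *
    qpochhammer_inf (q ^ 2) (q ^ 2)"
proof -
  define p where "p = q ^ 2"
  define L where "L = qpochhammer_inf p p"
  define G where "G n k = gauss_binomial p (2 * n) k" for n k
  have p: "norm p < 1"
    unfolding p_def using q by (rule norm_power_less_one) simp
  have L0: "L \<noteq> 0"
    unfolding L_def by (rule qpochhammer_inf_nonzero[OF p p])
  have lim: "qpoch p p \<longlonglongrightarrow> L"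
    unfolding L_def by (rule qpoch_LIMSEQ[OF p])
  obtain K1 where K1: "\<And>n. norm (qpoch p p n) \<le> K1"
    using convergent_imp_Bseq[OF convergentI[OF lim]] by (auto simp: Bseq_def)
  obtain K2 where K2: "\<And>n. norm (inverse (qpoch p p n)) \<le> K2"
    using convergent_imp_Bseq[OF convergentI[OF tendsto_inverse[OF lim L0]]] by (auto simp: Bseq_def)
  have K_pos: "0 \<le> K1" "0 \<le> K2"
    using K1[of 0] K2[of 0] by simp_all
  \<comment> \<open>The majorant for Tannery's theorem: (p;p)_n is bounded, and so is its inverse
    because the limit \<open>L\<close> is nonzero.\<close>
  have G_le: "norm (G n k) \<le> K1 * (K2 * K2)" for n k
  proof (cases "k \<le> 2 * n")
    case True
    then have "norm (G n k) = norm (qpoch p p (2 * n)) *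
        (norm (inverse (qpoch p p k)) * norm (inverse (qpoch p p (2 * n - k))))"
      by (simp add: G_def gauss_binomial_def norm_mult norm_divide norm_inverse divide_inverse)
    also have "\<dots> \<le> K1 * (K2 * K2)"
      by (intro mult_mono K1 K2 mult_nonneg_nonneg norm_ge_zero K_pos)
    finally show ?thesis .
  qed (use K_pos in \<open>simp add: G_def\<close>)
  have sub: "(\<lambda>n. qpoch p p (f n)) \<longlonglongrightarrow> L" if "filterlim f at_top sequentially" for f
    using filterlim_compose[OF lim that] .
  have G_lim: "(\<lambda>n. G n (f n)) \<longlonglongrightarrow> 1 / L"
    if f: "filterlim f at_top sequentially" "filterlim (\<lambda>n. 2 * n - f n) at_top sequentially"
      "eventually (\<lambda>n. f n \<le> 2 * n) sequentially" for f
  proof -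
    have "filterlim (\<lambda>n. 2 * n :: nat) at_top sequentially"
      by (intro filterlim_subseq) (simp add: strict_mono_def)
    then have "(\<lambda>n. qpoch p p (2 * n) / (qpoch p p (f n) * qpoch p p (2 * n - f n))) \<longlonglongrightarrow> L / (L * L)"
      using L0 f by (intro tendsto_intros sub) auto
    moreover have "eventually (\<lambda>n. qpoch p p (2 * n) / (qpoch p p (f n) * qpoch p p (2 * n - f n)) = G n (f n))
        sequentially"
      using f(3) by eventually_elim (simp add: G_def gauss_binomial_def)
    ultimately show ?thesis
      using L0 by (simp add: tendsto_cong)
  qed
  have tannery: "(\<lambda>n. \<Sum>m<n. c n m * (q ^ (h m ^ 2) * w ^ h m)) \<longlonglongrightarrow> (\<Sum>m. 1 / L * (q ^ (h m ^ 2) * w ^ h m))"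
    if c: "\<And>m. (\<lambda>n. c n m) \<longlonglongrightarrow> 1 / L" "\<And>n m. norm (c n m) \<le> K1 * (K2 * K2)"
      and h: "summable (\<lambda>m. norm (q ^ (h m ^ 2) * w ^ h m))"
    for c :: "nat \<Rightarrow> nat \<Rightarrow> complex" and h :: "nat \<Rightarrow> nat" and w :: complex
  proof -
    \<comment> \<open>Extension by zero turns the sums of growing length into series over all
      m.\<close>
    define a where "a m n = (if m < n then c n m * (q ^ (h m ^ 2) * w ^ h m) else 0)" for m n
    have "(\<lambda>n. \<Sum>m. a m n) \<longlonglongrightarrow> (\<Sum>m. 1 / L * (q ^ (h m ^ 2) * w ^ h m))"
    proof (rule tannerys_theorem[THEN conjunct2, THEN conjunct2])
      fix m
      have "(\<lambda>n. c n m * (q ^ (h m ^ 2) * w ^ h m)) \<longlonglongrightarrow> 1 / L * (q ^ (h m ^ 2) * w ^ h m)"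
        by (intro tendsto_intros c)
      moreover have "\<forall>\<^sub>F n in sequentially. c n m * (q ^ (h m ^ 2) * w ^ h m) = a m n"
        using eventually_gt_at_top[of m] by eventually_elim (simp add: a_def)
      ultimately show "a m \<longlonglongrightarrow> 1 / L * (q ^ (h m ^ 2) * w ^ h m)"
        by (rule Lim_transform_eventually)
    next
      show "summable (\<lambda>m. K1 * (K2 * K2) * norm (q ^ (h m ^ 2) * w ^ h m))"
        by (intro summable_mult h)
      have "norm (a m n) \<le> K1 * (K2 * K2) * norm (q ^ (h m ^ 2) * w ^ h m)" for m n
        using c(2)[of n m] K_pos
        by (auto simp: a_def norm_mult intro!: mult_right_mono)
      then show "\<forall>\<^sub>F (m, n) in sequentially \<times>\<^sub>F sequentially.
          norm (a m n) \<le> K1 * (K2 * K2) * norm (q ^ (h m ^ 2) * w ^ h m)"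
        by (intro always_eventually) auto
    qed simp
    moreover have "(\<Sum>m. a m n) = (\<Sum>m<n. c n m * (q ^ (h m ^ 2) * w ^ h m))" for n
      by (subst suminf_finite[of "{..<n}"]) (auto simp: a_def)
    ultimately show ?thesis by simp
  qed
  have summ: "summable (\<lambda>m. norm (q ^ (m ^ 2) * z ^ m))"
    "summable (\<lambda>m. norm (q ^ (Suc m ^ 2) * inverse z ^ Suc m))"
    using summable_norm_theta[OF q, of z]
      iffD2[OF summable_Suc_iff summable_norm_theta[OF q, of "inverse z"]] by blast+
  \<comment> \<open>The last index j = 2n has coefficient 1 and stands apart, so that both sums run
    over m < n; its term tends to 0.\<close>
  have finite_form: "(\<Sum>m<n. G n (n + m) * (q ^ (m ^ 2) * z ^ m)) + q ^ (n ^ 2) * z ^ n +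
      (\<Sum>m<n. G n (n - Suc m) * (q ^ (Suc m ^ 2) * inverse z ^ Suc m)) =
      qpoch (- (z * q)) p n * qpoch (- (inverse z * q)) p n" for n
  proof -
    define f where "f j = G n j * q ^ nat ((int n - int j) ^ 2) * z ^ j" for j
    have "z ^ n * (qpoch (- (z * q)) p n * qpoch (- (inverse z * q)) p n) =
        (\<Prod>k<n. z * (1 + inverse z * q * p ^ k)) * (\<Prod>k<n. 1 + z * q * p ^ k)"
      by (simp add: qpoch_def prod.distrib mult_ac)
    also have "\<dots> = (\<Prod>k<n. z + q ^ (2 * k + 1)) * (\<Prod>k<n. 1 + z * q ^ (2 * k + 1))"
    proof (intro arg_cong2[of _ _ _ _ "(*)"] prod.cong refl)
      fix k
      have qp: "q ^ (2 * k + 1) = q * p ^ k"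
        by (simp add: p_def power_mult)
      show "1 + z * q * p ^ k = 1 + z * q ^ (2 * k + 1)"
        by (simp only: qp mult.assoc)
      have "z * (1 + inverse z * q * p ^ k) = z + z * inverse z * (q * p ^ k)"
        by (simp only: distrib_left mult_1_right mult.assoc)
      then show "z * (1 + inverse z * q * p ^ k) = z + q ^ (2 * k + 1)"
        unfolding qp using z by simp
    qed
    also have "\<dots> = (\<Sum>j\<le>n + n. f j)"
      unfolding prod_eq_sum_gauss_binomial[OF q] by (simp add: f_def G_def p_def mult_2)
    also have "\<dots> = (\<Sum>j<n. f j) + (\<Sum>j\<in>{n..<n + n}. f j) + f (n + n)"
      using sum.atLeastLessThan_concat[of 0 n "n + n" f]
      by (simp add: atLeast0LessThan flip: lessThan_Suc_atMost)
    also have "(\<Sum>j\<in>{n..<n + n}. f j) = (\<Sum>m<n. f (n + m))"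
      using sum.shift_bounds_nat_ivl[of f 0 n n] by (simp add: atLeast0LessThan add.commute)
    also have "\<dots> = z ^ n * (\<Sum>m<n. G n (n + m) * (q ^ (m ^ 2) * z ^ m))"
      unfolding sum_distrib_left
      by (intro sum.cong) (simp_all add: f_def power_add mult_ac nat_power_eq)
    also have "f (n + n) = z ^ n * (q ^ (n ^ 2) * z ^ n)"
    proof -
      have "G n (n + n) = 1"
        using qpoch_nonzero[OF p p] by (simp add: G_def gauss_binomial_def flip: mult_2)
      then show ?thesis by (simp add: f_def power_add nat_power_eq)
    qed
    also have "(\<Sum>j<n. f j) = (\<Sum>m<n. f (n - Suc m))"
      by (rule sum.nat_diff_reindex[symmetric])
    also have "\<dots> = z ^ n * (\<Sum>m<n. G n (n - Suc m) * (q ^ (Suc m ^ 2) * inverse z ^ Suc m))"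
      unfolding sum_distrib_left
    proof (intro sum.cong refl)
      fix m assume "m \<in> {..<n}"
      then have n: "n = (n - Suc m) + Suc m" and i: "int n - int (n - Suc m) = int (Suc m)" by auto
      have "z ^ (n - Suc m) = z ^ n * inverse z ^ Suc m"
        using z by (subst (2) n) (simp add: power_add field_simps power_inverse)
      moreover have "nat ((int n - int (n - Suc m)) ^ 2) = Suc m ^ 2"
        unfolding i by (simp only: nat_power_eq of_nat_0_le_iff nat_int)
      ultimately show "f (n - Suc m) =
          z ^ n * (G n (n - Suc m) * (q ^ (Suc m ^ 2) * inverse z ^ Suc m))"
        by (simp only: f_def mult_ac)
    qed
    finally have "z ^ n * (qpoch (- (z * q)) p n * qpoch (- (inverse z * q)) p n) =
        z ^ n * ((\<Sum>m<n. G n (n + m) * (q ^ (m ^ 2) * z ^ m)) + q ^ (n ^ 2) * z ^ n +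
      (\<Sum>m<n. G n (n - Suc m) * (q ^ (Suc m ^ 2) * inverse z ^ Suc m)))"
      by (simp only: distrib_left add_ac)
    then show ?thesis using z by simp
  qed
  have G_lim1: "(\<lambda>n. G n (n + m)) \<longlonglongrightarrow> 1 / L" for m
  proof (rule G_lim)
    show "filterlim (\<lambda>n. n + m) at_top sequentially"
      by (rule filterlim_add_const_nat_at_top)
    show "filterlim (\<lambda>n. 2 * n - (n + m)) at_top sequentially"
      using filterlim_minus_const_nat_at_top[of m] by (simp add: mult_2)
    show "\<forall>\<^sub>F n in sequentially. n + m \<le> 2 * n"
      using eventually_ge_at_top[of m] by eventually_elim simp
  qed
  have G_lim2: "(\<lambda>n. G n (n - Suc m)) \<longlonglongrightarrow> 1 / L" for m
  proof (rule G_lim)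
    show "filterlim (\<lambda>n. n - Suc m) at_top sequentially"
      by (rule filterlim_minus_const_nat_at_top)
    show "filterlim (\<lambda>n. 2 * n - (n - Suc m)) at_top sequentially"
      by (rule filterlim_at_top_mono[OF filterlim_ident]) (auto intro!: always_eventually)
  qed (auto intro!: always_eventually)
  have "(\<lambda>n. (\<Sum>m<n. G n (n + m) * (q ^ (m ^ 2) * z ^ m)) + q ^ (n ^ 2) * z ^ n +
      (\<Sum>m<n. G n (n - Suc m) * (q ^ (Suc m ^ 2) * inverse z ^ Suc m))) \<longlonglongrightarrow>
      (\<Sum>m. 1 / L * (q ^ (m ^ 2) * z ^ m)) + 0 +
      (\<Sum>m. 1 / L * (q ^ (Suc m ^ 2) * inverse z ^ Suc m))"
    by (intro tendsto_add tannery G_lim1 G_lim2 G_le summ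
        summable_LIMSEQ_zero[OF summable_norm_cancel])
  then have "(\<lambda>n. qpoch (- (z * q)) p n * qpoch (- (inverse z * q)) p n) \<longlonglongrightarrow>
      (\<Sum>m. 1 / L * (q ^ (m ^ 2) * z ^ m)) + 0 +
      (\<Sum>m. 1 / L * (q ^ (Suc m ^ 2) * inverse z ^ Suc m))"
    by (simp only: finite_form)
  moreover have "(\<lambda>n. qpoch (- (z * q)) p n * qpoch (- (inverse z * q)) p n) \<longlonglongrightarrow>
      qpochhammer_inf (- (z * q)) p * qpochhammer_inf (- (inverse z * q)) p"
    by (intro tendsto_intros qpoch_LIMSEQ p)
  ultimately have "qpochhammer_inf (- (z * q)) p * qpochhammer_inf (- (inverse z * q)) p =
      (\<Sum>m. 1 / L * (q ^ (m ^ 2) * z ^ m)) + (\<Sum>m. 1 / L * (q ^ (Suc m ^ 2) * inverse z ^ Suc m))"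
    using LIMSEQ_unique by fastforce
  also have "\<dots> = 1 / L * ((\<Sum>m. q ^ (m ^ 2) * z ^ m) + (\<Sum>m. q ^ (Suc m ^ 2) * inverse z ^ Suc m))"
    by (simp only: suminf_mult[OF summable_norm_cancel[OF summ(1)]]
        suminf_mult[OF summable_norm_cancel[OF summ(2)]] distrib_left)
  finally show ?thesis
    using L0 by (simp add: L_def p_def field_simps)
qed

section \<open>Theta functions of the squares and of the triangular numbers\<close>

text \<open>Even squares cancel and odd squares double. Each odd square (2k + 1)^2 = 4(k^2 + k) + 1
  occurs once in either sum, which makes the factor 4 x.\<close>

lemma theta_odd_part:
  fixes x :: complex
  assumes x: "norm x < 1"
  shows "((\<Sum>m. x ^ (m ^ 2)) + (\<Sum>m. x ^ (Suc m ^ 2))) -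
      ((\<Sum>m. (- x) ^ (m ^ 2)) + (\<Sum>m. (- x) ^ (Suc m ^ 2))) =
    4 * x * (\<Sum>k. (x ^ 4) ^ (k ^ 2 + k))"
proof -
  have y: "norm (x ^ 4) < 1"
    using x by (rule norm_power_less_one) simp
  have summ: "summable (\<lambda>m. w ^ (m ^ 2))" "summable (\<lambda>m. w ^ (Suc m ^ 2))"
    if "norm w < 1" for w :: complex
  proof -
    show *: "summable (\<lambda>m. w ^ (m ^ 2))"
      using summable_norm_cancel[OF summable_norm_theta[OF that, of 1]] by simp
    show "summable (\<lambda>m. w ^ (Suc m ^ 2))"
      using iffD2[OF summable_Suc_iff *] .
  qed
  define S where "S = (\<Sum>k. (x ^ 4) ^ (k ^ 2 + k))"
  have "summable (\<lambda>k. (x ^ 4) ^ (k ^ 2 + k))"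
    using summable_norm_cancel[OF summable_norm_theta[OF y, of "x ^ 4"]] by (simp add: power_add)
  then have "(\<lambda>k. 2 * x * (x ^ 4) ^ (k ^ 2 + k)) sums (2 * x * S)"
    unfolding S_def by (intro sums_mult summable_sums)
  moreover have "2 * x * (x ^ 4) ^ (k ^ 2 + k) = 2 * x ^ ((2 * k + 1) ^ 2)" for k
    by (simp add: power2_eq_square algebra_simps flip: power_mult power_add power_Suc)
  ultimately have S: "(\<lambda>k. 2 * x ^ ((2 * k + 1) ^ 2)) sums (2 * x * S)"
    by simp
  have "(\<lambda>m. x ^ (m ^ 2) - (- x) ^ (m ^ 2)) sums (2 * x * S)"
  proof (subst sums_mono_reindex[of "\<lambda>k. 2 * k + 1", symmetric])
    fix m :: nat
    assume "m \<notin> range (\<lambda>k. 2 * k + 1)"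
    then have "even m" by (metis oddE rangeI)
    then show "x ^ (m ^ 2) - (- x) ^ (m ^ 2) = 0" by simp
  qed (use S in \<open>simp_all add: strict_mono_def\<close>)
  then have "(\<Sum>m. x ^ (m ^ 2) - (- x) ^ (m ^ 2)) = 2 * x * S"
    by (simp add: sums_iff)
  moreover have "(\<Sum>m. x ^ (m ^ 2) - (- x) ^ (m ^ 2)) = (\<Sum>m. x ^ (m ^ 2)) - (\<Sum>m. (- x) ^ (m ^ 2))"
    using x by (intro suminf_diff [symmetric] summ) auto
  moreover have "(\<lambda>m. x ^ (Suc m ^ 2) - (- x) ^ (Suc m ^ 2)) sums (2 * x * S)"
  \<comment> \<open>The base is now \<open>Suc m\<close>, so the surviving terms have even
    m.\<close>
  proof (subst sums_mono_reindex[of "\<lambda>k. 2 * k", symmetric])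
    fix m :: nat
    assume "m \<notin> range (\<lambda>k. 2 * k)"
    then have "odd m" by (metis evenE rangeI)
    then show "x ^ (Suc m ^ 2) - (- x) ^ (Suc m ^ 2) = 0" by simp
  qed (use S in \<open>simp_all add: strict_mono_def\<close>)
  then have "(\<Sum>m. x ^ (Suc m ^ 2) - (- x) ^ (Suc m ^ 2)) = 2 * x * S"
    by (simp add: sums_iff)
  moreover have "(\<Sum>m. x ^ (Suc m ^ 2) - (- x) ^ (Suc m ^ 2)) =
      (\<Sum>m. x ^ (Suc m ^ 2)) - (\<Sum>m. (- x) ^ (Suc m ^ 2))"
    using x by (intro suminf_diff [symmetric] summ) auto
  ultimately show ?thesis
    by (simp add: S_def algebra_simps)
qed

text \<open>The triple product at z = y yields every exponent k^2 + k twice, once from each sum, and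
  (-1;y^2) contains the matching factor 2. The case y = 0 is separate since z must be
  nonzero.\<close>

lemma gauss_triangular_numbers:
  assumes y: "norm y < 1"
  shows "(\<Sum>k. y ^ (k ^ 2 + k)) * qpochhammer_inf (y ^ 2) (y ^ 2) = qpochhammer_inf (y ^ 4) (y ^ 4) ^ 2"
proof (cases "y = 0")
  case True
  have "qpochhammer_inf 0 0 = 1"
    by (simp add: qpochhammer_inf_def)
  moreover have "(\<Sum>k. (0 :: complex) ^ (k ^ 2 + k)) = 1"
    using sums_single[of 0 "\<lambda>_. 1 :: complex"] by (simp add: sums_iff power_0_left cong: if_cong)
  ultimately show ?thesis using True by simp
next
  case False
  have y2: "norm (y ^ 2) < 1"
    using y by (rule norm_power_less_one) simp
  have shift: "y ^ (Suc k ^ 2) * inverse y ^ Suc k = y ^ (k ^ 2 + k)" for k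
  proof -
    have "y ^ (Suc k ^ 2) = y ^ (k ^ 2 + k) * y ^ Suc k"
      by (simp add: power2_eq_square algebra_simps flip: power_add power_Suc)
    moreover have "y ^ Suc k * inverse y ^ Suc k = 1"
      using False by (simp flip: power_mult_distrib del: power_Suc)
    ultimately show ?thesis by (simp only: mult.assoc mult_1_right)
  qed
  have "2 * (\<Sum>k. y ^ (k ^ 2 + k)) = qpochhammer_inf (- (y ^ 2)) (y ^ 2) *
      qpochhammer_inf (- 1) (y ^ 2) * qpochhammer_inf (y ^ 2) (y ^ 2)"
    using jacobi_triple_product[OF y False] False
    unfolding shift power_add [symmetric] by (simp add: power2_eq_square)
  also have "qpochhammer_inf (- 1) (y ^ 2) = 2 * qpochhammer_inf (- (y ^ 2)) (y ^ 2)"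
    using qpochhammer_inf_step[OF y2, of "- 1"] by simp
  finally have S: "(\<Sum>k. y ^ (k ^ 2 + k)) =
      qpochhammer_inf (- (y ^ 2)) (y ^ 2) ^ 2 * qpochhammer_inf (y ^ 2) (y ^ 2)"
    by (simp add: power2_eq_square)
  have "qpochhammer_inf (y ^ 2) (y ^ 2) * qpochhammer_inf (- (y ^ 2)) (y ^ 2) = qpochhammer_inf (y ^ 4) (y ^ 4)"
    using qpochhammer_inf_plus_minus[OF y2, of "y ^ 2"] by simp
  from this [symmetric] show ?thesis
    unfolding S by (simp add: power_mult_distrib power2_eq_square mult_ac)
qed

text \<open>The triple product at z = 1, taken at x and at -x, identifies both terms as theta series
  of squares; their difference is the triangular series at y = x^4.\<close>

lemma theta_difference:
  assumes x: "norm x < 1"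
  shows "qpochhammer_inf (- x) (x ^ 2) ^ 2 * qpochhammer_inf (x ^ 2) (x ^ 2) -
      qpochhammer_inf x (x ^ 2) ^ 2 * qpochhammer_inf (x ^ 2) (x ^ 2) =
    4 * x * (qpochhammer_inf (x ^ 16) (x ^ 16) ^ 2 / qpochhammer_inf (x ^ 8) (x ^ 8))"
proof -
  have phi: "(\<Sum>m. w ^ (m ^ 2)) + (\<Sum>m. w ^ (Suc m ^ 2)) =
      qpochhammer_inf (- w) (w ^ 2) ^ 2 * qpochhammer_inf (w ^ 2) (w ^ 2)"
    if "norm w < 1" for w :: complex
    using jacobi_triple_product[OF that, of 1] by (simp add: power2_eq_square)
  have y: "norm (x ^ 4) < 1" "norm (x ^ 8) < 1"
    using x by (auto intro: norm_power_less_one)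
  have "(\<Sum>k. (x ^ 4) ^ (k ^ 2 + k)) = qpochhammer_inf (x ^ 16) (x ^ 16) ^ 2 / qpochhammer_inf (x ^ 8) (x ^ 8)"
    using gauss_triangular_numbers[OF y(1)] qpochhammer_inf_nonzero[OF y(2) y(2)]
    by (simp add: field_simps flip: power_mult)
  then show ?thesis
    using theta_odd_part[OF x] phi[of x] phi[of "- x"] x by simp
qed

section \<open>Generating functions of partitions\<close>

fun alternating_sum :: "nat list \<Rightarrow> int" where
  "alternating_sum [] = 0"
| "alternating_sum (x # xs) = int x - alternating_sum xs"

text \<open>A new first row of length x puts one box into each of the columns 1 to x and flips their
  parities, while later columns are empty. With \<open>N\<close> arbitrary, the induction hypothesis
  is available at N = x.\<close>

lemma card_odd_columns:
  assumes "sorted_wrt (\<ge>) xs" "set xs \<subseteq> {..N}"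
  shows "int (card {i \<in> {1..N}. odd (length (filter (\<lambda>p. i \<le> p) xs))}) = alternating_sum xs"
  using assms
proof (induction xs arbitrary: N)
  case (Cons x xs)
  let ?odd = "\<lambda>i. odd (length (filter (\<lambda>p. i \<le> p) xs))"
  have IH: "int (card {i \<in> {1..x}. ?odd i}) = alternating_sum xs"
    using Cons.prems by (intro Cons.IH) auto
  have "filter (\<lambda>p. i \<le> p) (x # xs) = []" if "i > x" for i
    using that Cons.prems by (auto simp: filter_empty_conv)
  then have "{i \<in> {1..N}. odd (length (filter (\<lambda>p. i \<le> p) (x # xs)))} =
      {1..x} - {i \<in> {1..x}. ?odd i}"
    using Cons.prems by (force simp: not_le [symmetric])
  also have "int (card \<dots>) = int x - int (card {i \<in> {1..x}. ?odd i})"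
    by (subst card_Diff_subset) (auto intro!: of_nat_diff card_mono[of "{1..x}", simplified])
  finally show ?case using IH by simp
qed simp

lemma odd_parts_conjugate:
  assumes "sorted_wrt (\<ge>) xs"
  shows "int (odd_parts (conjugate xs)) = alternating_sum xs"
proof (cases xs)
  case (Cons x ys)
  have odd: "odd_parts (conjugate xs) = card {i \<in> {1..x}. odd (length (filter (\<lambda>p. i \<le> p) xs))}"
    by (auto simp: Cons odd_parts_def filter_map distinct_length_filter intro!: arg_cong[of _ _ card])
  have "set xs \<subseteq> {..x}" using assms Cons by auto
  from card_odd_columns[OF assms this] show ?thesis by (simp only: odd)
qed (simp add: odd_parts_def)

text \<open>Together with \<open>even_alternating_sum\<close> this gives both statistics the parity
  of n, which makes the weights for y = -i and z = i equal to 1 or -1.\<close>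

lemma even_odd_parts: "even (odd_parts xs) \<longleftrightarrow> even (sum_list xs)"
  by (induction xs) (auto simp: odd_parts_def)

lemma even_alternating_sum: "even (alternating_sum xs) \<longleftrightarrow> even (sum_list xs)"
  by (induction xs) auto

section \<open>Partitions with bounded parts and convergence\<close>

definition partitions_le :: "nat \<Rightarrow> nat \<Rightarrow> nat list set" where
  "partitions_le N n = {xs \<in> partitions n. set xs \<subseteq> {..N}}"

lemma finite_partitions_le [simp]: "finite (partitions_le N n)"
  unfolding partitions_le_def using finite_partitions by (rule finite_subset[rotated]) auto

lemma partitions_le_0: "partitions_le 0 n = (if n = 0 then {[]} else {})"
  by (auto simp: partitions_le_def partitions_def subset_singleton_iff)

lemma partitions_le_self:
  assumes "n \<le> N"
  shows "partitions_le N n = partitions n"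
  using assms member_le_sum_list by (fastforce simp: partitions_le_def partitions_def)

text \<open>If \<open>Suc N\<close> occurs as a part it is the head, by sortedness. Only one copy is
  removed, so the tail may contain it again.\<close>

lemma partitions_le_Suc:
  "partitions_le (Suc N) n = partitions_le N n \<union>
    (if Suc N \<le> n then (#) (Suc N) ` partitions_le (Suc N) (n - Suc N) else {})"
proof (intro equalityI subsetI)
  fix xs assume xs: "xs \<in> partitions_le (Suc N) n"
  show "xs \<in> partitions_le N n \<union>
      (if Suc N \<le> n then (#) (Suc N) ` partitions_le (Suc N) (n - Suc N) else {})"
  proof (cases "Suc N \<in> set xs")
    case True
    then obtain x ys where ys: "xs = x # ys" by (cases xs) auto
    have "x = Suc N"
      using True xs by (auto simp: ys partitions_le_def partitions_def)
    then show ?thesis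
      using xs by (auto simp: ys partitions_le_def partitions_def)
  next
    case False
    then have "set xs \<subseteq> {..N}"
      using xs by (auto simp: partitions_le_def le_Suc_eq)
    then show ?thesis
      using xs by (simp add: partitions_le_def)
  qed
next
  fix xs
  assume "xs \<in> partitions_le N n \<union>
      (if Suc N \<le> n then (#) (Suc N) ` partitions_le (Suc N) (n - Suc N) else {})"
  then show "xs \<in> partitions_le (Suc N) n"
    by (auto simp: partitions_le_def partitions_def split: if_splits)
qed

lemma sum_partitions_le_Suc:
  fixes f :: "nat list \<Rightarrow> 'a :: comm_monoid_add"
  shows "sum f (partitions_le (Suc N) n) = sum f (partitions_le N n) +
    (if Suc N \<le> n then \<Sum>xs\<in>partitions_le (Suc N) (n - Suc N). f (Suc N # xs) else 0)"
proof -
  let ?A = "if Suc N \<le> n then (#) (Suc N) ` partitions_le (Suc N) (n - Suc N) else {}"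
  have "partitions_le N n \<inter> ?A = {}"
    by (auto simp: partitions_le_def)
  then have "sum f (partitions_le (Suc N) n) = sum f (partitions_le N n) + sum f ?A"
    unfolding partitions_le_Suc[of N n] by (intro sum.union_disjoint) auto
  also have "sum f ?A =
      (if Suc N \<le> n then \<Sum>xs\<in>partitions_le (Suc N) (n - Suc N). f (Suc N # xs) else 0)"
    by (simp add: sum.reindex)
  finally show ?thesis .
qed

text \<open>The truncated sums satisfy S(N+1,K)(1 - r^(N+1)) <= S(N,K), hence S(N,K) <= 1/P(N), and
  these bounds are themselves bounded. The choice N = K covers every partition of each n <
  K.\<close>

lemma summable_p_count:
  fixes r :: real
  assumes r: "0 \<le> r" "r < 1"
  shows "summable (\<lambda>n. real (p_count n) * r ^ n)"
proof -
  define c where "c N n = real (card (partitions_le N n))" for N n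
  define S where "S N K = (\<Sum>n<K. c N n * r ^ n)" for N K
  define P where "P N = (\<Prod>k<N. 1 - r * r ^ k)" for N
  have c_Suc: "c (Suc N) n = c N n + (if Suc N \<le> n then c (Suc N) (n - Suc N) else 0)" for N n
    using sum_partitions_le_Suc[of "\<lambda>_. 1 :: real" N n] by (simp add: c_def)
  have rk: "r * r ^ k < 1" for k
    using r mult_left_le[of "r ^ k" r] power_le_one[of r k] by linarith
  have Ppos: "P N > 0" for N
    unfolding P_def by (intro prod_pos) (simp add: rk)
  have "S N K * P N \<le> 1" for N K
  proof (induction N)
    case 0
    have "S 0 K \<le> (\<Sum>n<K. if n = 0 then 1 else 0)"
      unfolding S_def by (intro sum_mono) (simp add: c_def partitions_le_0)
    also have "\<dots> \<le> 1" by simp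
    finally show ?case by (simp add: P_def)
  next
    case (Suc N)
    have "S (Suc N) K = S N K + (\<Sum>n<K. if Suc N \<le> n then c (Suc N) (n - Suc N) * r ^ n else 0)"
      unfolding S_def sum.distrib [symmetric]
      by (rule sum.cong[OF refl], subst c_Suc) (simp add: distrib_right)
    also have "(\<Sum>n<K. if Suc N \<le> n then c (Suc N) (n - Suc N) * r ^ n else 0) =
        (\<Sum>n\<in>{Suc N..<K}. c (Suc N) (n - Suc N) * r ^ n)"
      by (intro sum.mono_neutral_cong_right) auto
    also have "\<dots> = (\<Sum>n<K - Suc N. c (Suc N) n * r ^ (n + Suc N))"
      by (rule sum.reindex_bij_witness[of _ "\<lambda>n. n + Suc N" "\<lambda>n. n - Suc N"]) auto
    \<comment> \<open>Restoring the full range \<open>K\<close> only adds nonnegative terms and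
      closes the recursion on \<open>S (Suc N) K\<close>.\<close>
    also have "\<dots> \<le> (\<Sum>n<K. c (Suc N) n * r ^ (n + Suc N))"
      using r by (intro sum_mono2) (auto simp: c_def)
    also have "\<dots> = r ^ Suc N * S (Suc N) K"
      by (simp add: S_def sum_distrib_left power_add mult_ac)
    finally have "S (Suc N) K * (1 - r * r ^ N) \<le> S N K"
      by (simp add: algebra_simps)
    then have "S (Suc N) K * (1 - r * r ^ N) * P N \<le> S N K * P N"
      using Ppos by (intro mult_right_mono) (auto intro: less_imp_le)
    then show ?case using Suc.IH by (simp add: P_def mult_ac)
  qed
  then have S_le: "S N K \<le> inverse (P N)" for N K
    using Ppos by (simp add: field_simps)
  \<comment> \<open>The inverses of \<open>P N\<close> are bounded because the infinite product
    (r;r) is nonzero; this is read off from the complex product.\<close>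
  have "norm (complex_of_real r) < 1" using r by simp
  from tendsto_inverse[OF qpoch_LIMSEQ[OF this] qpochhammer_inf_nonzero[OF this this]]
  have "Bseq (\<lambda>N. inverse (qpoch (of_real r) (of_real r) N))"
    by (intro convergent_imp_Bseq convergentI)
  then obtain M where M: "norm (inverse (qpoch (of_real r) (of_real r) N)) \<le> M" for N
    by (auto simp: Bseq_def)
  have "qpoch (of_real r) (of_real r) N = of_real (P N)" for N
    by (simp add: qpoch_def P_def)
  then have P_le: "inverse (P N) \<le> M" for N
    using M[of N] Ppos[of N] by (simp add: norm_inverse)
  show ?thesis
  proof (rule summableI_nonneg_bounded)
    fix K
    have "(\<Sum>n<K. real (p_count n) * r ^ n) = S K K"
      unfolding S_def by (intro sum.cong) (auto simp: c_def p_count_def partitions_le_self)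
    also have "\<dots> \<le> M" using S_le P_le order_trans by blast
    finally show "(\<Sum>n<K. real (p_count n) * r ^ n) \<le> M" .
  qed (use r in auto)
qed

text \<open>By \<open>odd_parts_conjugate\<close>, the exponent of \<open>y\<close> is \<open>\<O>(\<lambda>')\<close>.\<close>

definition weight :: "complex \<Rightarrow> complex \<Rightarrow> nat list \<Rightarrow> complex" where
  "weight y z xs = z ^ odd_parts xs * y powi alternating_sum xs"

lemma weight_Nil [simp]: "weight y z [] = 1"
  by (simp add: weight_def odd_parts_def)

text \<open>The alternating sum of the tail enters with a minus sign, so the tail is weighted by
  \<open>inverse y\<close>. This couples the generating functions for \<open>y\<close> and
  \<open>inverse y\<close>.\<close>

lemma weight_Cons:
  assumes "y \<noteq> 0"
  shows "weight y z (x # xs) = (if odd x then z else 1) * y ^ x * weight (inverse y) z xs"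
  using assms
  by (simp add: weight_def odd_parts_def power_int_diff power_int_inverse divide_inverse)

lemma norm_weight:
  assumes "norm y = 1" "norm z = 1"
  shows "norm (weight y z xs) = 1"
  using assms by (simp add: weight_def norm_mult norm_power norm_power_int)

section \<open>Weighted generating functions and their recurrence\<close>

definition gf_le :: "complex \<Rightarrow> complex \<Rightarrow> nat \<Rightarrow> complex \<Rightarrow> complex" where
  "gf_le y z N q = (\<Sum>n. sum (weight y z) (partitions_le N n) * q ^ n)"

definition gf :: "complex \<Rightarrow> complex \<Rightarrow> complex \<Rightarrow> complex" where
  "gf y z q = (\<Sum>n. sum (weight y z) (partitions n) * q ^ n)"

context
  fixes y z q :: complex
  assumes yz: "norm y = 1" "norm z = 1" and q: "norm q < 1"
begin

lemma norm_sum_weight_le: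
  assumes "A \<subseteq> partitions n"
  shows "norm (sum (weight y z) A * q ^ n) \<le> real (p_count n) * norm q ^ n"
proof -
  have "norm (sum (weight y z) A) \<le> (\<Sum>xs\<in>A. norm (weight y z xs))"
    by (rule norm_sum)
  also have "\<dots> = real (card A)"
    by (simp add: norm_weight yz)
  also have "\<dots> \<le> real (p_count n)"
    using assms finite_partitions by (simp add: p_count_def card_mono)
  finally show ?thesis
    by (simp add: norm_mult norm_power mult_right_mono)
qed

lemma gf_le_sums:
  "(\<lambda>n. sum (weight y z) (partitions_le N n) * q ^ n) sums gf_le y z N q"
  unfolding gf_le_def
proof (rule summable_sums, rule summable_comparison_test')
  show "summable (\<lambda>n. real (p_count n) * norm q ^ n)"
    using q by (intro summable_p_count) auto
qed (auto intro!: norm_sum_weight_le simp: partitions_le_def)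

lemma gf_sums: "(\<lambda>n. sum (weight y z) (partitions n) * q ^ n) sums gf y z q"
  unfolding gf_def
proof (rule summable_sums, rule summable_comparison_test')
  show "summable (\<lambda>n. real (p_count n) * norm q ^ n)"
    using q by (intro summable_p_count) auto
qed (auto intro!: norm_sum_weight_le)

text \<open>The n-th coefficient is constant in N once N >= n, and p(n) |q|^n is a majorant
  independent of N, because the weights have norm 1.\<close>

lemma gf_le_LIMSEQ: "(\<lambda>N. gf_le y z N q) \<longlonglongrightarrow> gf y z q"
proof -
  have "((\<lambda>N. \<Sum>n. sum (weight y z) (partitions_le N n) * q ^ n) \<longlongrightarrow>
      (\<Sum>n. sum (weight y z) (partitions n) * q ^ n)) sequentially"
  proof (rule tannerys_theorem[THEN conjunct2, THEN conjunct2])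
    fix n
    have "\<forall>\<^sub>F N in sequentially. sum (weight y z) (partitions_le N n) * q ^ n =
        sum (weight y z) (partitions n) * q ^ n"
      using eventually_ge_at_top[of n] by eventually_elim (simp add: partitions_le_self)
    then show "(\<lambda>N. sum (weight y z) (partitions_le N n) * q ^ n) \<longlonglongrightarrow>
        sum (weight y z) (partitions n) * q ^ n"
      by (rule tendsto_eventually)
  next
    show "summable (\<lambda>n. real (p_count n) * norm q ^ n)"
      using q by (intro summable_p_count) auto
    show "\<forall>\<^sub>F (n, N) in sequentially \<times>\<^sub>F sequentially.
        norm (sum (weight y z) (partitions_le N n) * q ^ n) \<le> real (p_count n) * norm q ^ n"
      by (intro always_eventually) (auto intro!: norm_sum_weight_le simp: partitions_le_def)
  qed simp
  then show ?thesis by (simp add: gf_le_def gf_def)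
qed

end

lemma gf_le_0: "gf_le y z 0 q = 1"
proof -
  have "(\<lambda>n. sum (weight y z) (partitions_le 0 n) * q ^ n) = (\<lambda>n. if n = 0 then 1 else 0)"
    by (auto simp: partitions_le_0)
  then show ?thesis
    unfolding gf_le_def using sums_single[of 0 "\<lambda>_. 1 :: complex"] by (simp add: sums_iff)
qed

text \<open>Partitions containing the part N + 1 lose one copy of it, which inverts
  \<open>y\<close>; that part is odd, and contributes z, exactly when N is even.\<close>

lemma gf_le_Suc:
  assumes yz: "norm y = 1" "norm z = 1" and q: "norm q < 1"
  shows "gf_le y z (Suc N) q = gf_le y z N q +
    (if even N then z else 1) * (y * q) ^ Suc N * gf_le (inverse y) z (Suc N) q"
proof -
  define c where "c = (if even N then z else 1) * y ^ Suc N"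
  define g where "g n = (if Suc N \<le> n then
      c * sum (weight (inverse y) z) (partitions_le (Suc N) (n - Suc N)) * q ^ n else 0)" for n
  have y0: "y \<noteq> 0" and y': "norm (inverse y) = 1"
    using yz by (auto simp: norm_inverse)
  have split: "sum (weight y z) (partitions_le (Suc N) n) * q ^ n =
      sum (weight y z) (partitions_le N n) * q ^ n + g n" for n
    unfolding sum_partitions_le_Suc[of "weight y z"]
    by (simp add: g_def c_def weight_Cons[OF y0] sum_distrib_left distrib_right)
  have "(\<lambda>n. c * q ^ Suc N * (sum (weight (inverse y) z) (partitions_le (Suc N) n) * q ^ n))
      sums (c * q ^ Suc N * gf_le (inverse y) z (Suc N) q)"
    by (intro sums_mult gf_le_sums y' yz q)
  moreover have "g (n + Suc N) =
      c * q ^ Suc N * (sum (weight (inverse y) z) (partitions_le (Suc N) n) * q ^ n)" for n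
    by (simp add: g_def power_add)
  ultimately have "(\<lambda>n. g (n + Suc N)) sums (c * q ^ Suc N * gf_le (inverse y) z (Suc N) q)"
    by simp
  \<comment> \<open>The first N + 1 terms of \<open>g\<close> are 0.\<close>
  then have "g sums (c * q ^ Suc N * gf_le (inverse y) z (Suc N) q)"
    by (subst (asm) sums_iff_shift) (simp add: g_def)
  then have "(\<lambda>n. sum (weight y z) (partitions_le (Suc N) n) * q ^ n) sums
      (gf_le y z N q + c * q ^ Suc N * gf_le (inverse y) z (Suc N) q)"
    unfolding split by (intro sums_add gf_le_sums yz q)
  then have "gf_le y z (Suc N) q = gf_le y z N q + c * q ^ Suc N * gf_le (inverse y) z (Suc N) q"
    unfolding gf_le_def[of y z "Suc N"] by (rule sums_unique[symmetric])
  then show ?thesis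
    by (simp add: c_def power_mult_distrib mult_ac)
qed

text \<open>Euler's product: for y = z = 1 the recurrence involves one function only and
  telescopes.\<close>

lemma p_count_sums:
  assumes q: "norm q < 1"
  shows "(\<lambda>n. of_nat (p_count n) * q ^ n) sums (1 / qpochhammer_inf q q)"
proof -
  have "gf_le 1 1 N q * qpoch q q N = 1" for N
  proof (induction N)
    case (Suc N)
    have "gf_le 1 1 (Suc N) q = gf_le 1 1 N q + q ^ Suc N * gf_le 1 1 (Suc N) q"
      by (rule trans[OF gf_le_Suc[OF _ _ q]]) simp_all
    then have "gf_le 1 1 (Suc N) q - q ^ Suc N * gf_le 1 1 (Suc N) q = gf_le 1 1 N q"
      by (rule iffD2[OF diff_eq_eq])
    then have "(1 - q ^ Suc N) * gf_le 1 1 (Suc N) q = gf_le 1 1 N q"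
      by (simp only: left_diff_distrib mult_1_left)
    moreover have "gf_le 1 1 (Suc N) q * qpoch q q (Suc N) =
        ((1 - q ^ Suc N) * gf_le 1 1 (Suc N) q) * qpoch q q N"
      by (simp add: qpoch_Suc)
    ultimately show ?case
      using Suc.IH by (simp only:)
  qed (simp add: gf_le_0)
  moreover have "(\<lambda>N. gf_le 1 1 N q * qpoch q q N) \<longlonglongrightarrow> gf 1 1 q * qpochhammer_inf q q"
    by (intro tendsto_intros gf_le_LIMSEQ qpoch_LIMSEQ q) simp_all
  ultimately have "gf 1 1 q * qpochhammer_inf q q = 1"
    by (simp add: LIMSEQ_const_iff)
  then have "gf 1 1 q = 1 / qpochhammer_inf q q"
    using qpochhammer_inf_nonzero[OF q q] by (simp add: field_simps)
  moreover have "sum (weight 1 1) (partitions n) = of_nat (p_count n)" for n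
    by (simp add: weight_def p_count_def)
  ultimately show ?thesis
    using gf_sums[of 1 1 q] q by simp
qed

section \<open>Solution of the recurrence for the weights -i and i\<close>

text \<open>As i and -i are mutually inverse, the two functions form a closed system. Two steps, for
  the parts 2m + 1 and 2m + 2, are solved together; after multiplication by the product, the result
  is the recurrence \<open>qbin_conv_Suc\<close> for q and for -q.\<close>

lemma gf_le_eq_qbin_conv:
  assumes q: "norm q < 1"
  shows "gf_le (- \<i>) \<i> (2 * m) q * qpoch (- (q ^ 2)) (q ^ 4) m = qbin_conv q m \<and>
    gf_le \<i> \<i> (2 * m) q * qpoch (- (q ^ 2)) (q ^ 4) m = qbin_conv (- q) m"
proof (induction m)
  case 0
  then show ?case by (simp add: gf_le_0)
next
  case (Suc m)
  define F where "F N = gf_le (- \<i>) \<i> N q" for N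
  define H where "H N = gf_le \<i> \<i> N q" for N
  define W where "W = qpoch (- (q ^ 2)) (q ^ 4)"
  define t where "t = - (q ^ 2)"
  define c where "c = q * t ^ m"
  define s where "s = t ^ Suc m"
  have sq: "(\<i> * q) ^ 2 = t" "(- \<i> * q) ^ 2 = t"
    by (simp_all add: t_def power_mult_distrib)
  have "\<i> * (- \<i> * q) ^ Suc (2 * m) = c" "\<i> * (\<i> * q) ^ Suc (2 * m) = - c"
    unfolding power_Suc power_mult sq by (simp_all add: c_def mult.assoc)
  then have 1: "F (Suc (2 * m)) = F (2 * m) + c * H (Suc (2 * m))"
    "H (Suc (2 * m)) = H (2 * m) - c * F (Suc (2 * m))"
    unfolding F_def H_def using gf_le_Suc[of "- \<i>" \<i> q "2 * m"] gf_le_Suc[of \<i> \<i> q "2 * m"] q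
    by (auto simp del: power_Suc)
  have "(- \<i> * q) ^ (2 * Suc m) = s" "(\<i> * q) ^ (2 * Suc m) = s"
    unfolding power_mult sq by (simp_all add: s_def)
  then have 2: "F (2 * Suc m) = F (Suc (2 * m)) + s * H (2 * Suc m)"
    "H (2 * Suc m) = H (Suc (2 * m)) + s * F (2 * Suc m)"
    unfolding F_def H_def using gf_le_Suc[of "- \<i>" \<i> q "Suc (2 * m)"] gf_le_Suc[of \<i> \<i> q "Suc (2 * m)"] q
    by (auto simp del: power_Suc)
  \<comment> \<open>Elimination of the intermediate values at 2m + 1; the determinants of the two
    steps are 1 + c^2 and 1 - s^2.\<close>
  have aux: "(1 - s * s) * (1 + c * c) * F'' = (1 - s * c) * F0 + (c + s) * H0"
    "(1 - s * s) * (1 + c * c) * H'' = (1 + s * c) * H0 + (s - c) * F0"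
    if "F' = F0 + c * H'" "H' = H0 - c * F'" "F'' = F' + s * H''" "H'' = H' + s * F''"
    for F0 F' F'' H0 H' H'' :: complex
    using that by algebra+
  have tt: "t ^ m * t ^ m = q ^ (4 * m)"
  proof -
    have "t ^ m * t ^ m = (t * t) ^ m" by (simp add: power_mult_distrib)
    also have "t * t = q ^ 4" by (simp add: t_def flip: power_add)
    finally show ?thesis by (simp add: power_mult)
  qed
  have ss: "s * s = q ^ (4 * Suc m)"
  proof -
    have "s * s = t * t * (t ^ m * t ^ m)" by (simp add: s_def)
    also have "t * t = q ^ 4" by (simp add: t_def flip: power_add)
    finally show ?thesis unfolding tt by (simp flip: power_add)
  qed
  have sc: "s * c = - (q ^ (4 * m + 3))"
  proof -
    have "s * c = q * t * (t ^ m * t ^ m)" by (simp add: s_def c_def)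
    then show ?thesis
      unfolding tt by (simp add: t_def power_add power2_eq_square power3_eq_cube)
  qed
  have cc: "c * c = q ^ 2 * (q ^ 4) ^ m"
  proof -
    have "c * c = q ^ 2 * (t ^ m * t ^ m)" by (simp add: c_def power2_eq_square)
    then show ?thesis unfolding tt by (simp add: power_mult)
  qed
  \<comment> \<open>The next factor of the product absorbs the determinant 1 + c^2.\<close>
  have W: "W (Suc m) = W m * (1 + c * c)"
    by (simp add: W_def qpoch_Suc cc)
  have nz: "1 - s * s \<noteq> 0"
    unfolding ss using power_neq_one[OF q, of "4 * Suc m"] by simp
  have IH: "F (2 * m) * W m = qbin_conv q m" "H (2 * m) * W m = qbin_conv (- q) m"
    using Suc.IH by (simp_all add: F_def H_def W_def)
  have cs: "c + s = q * (1 - q) * t ^ m" "s - c = - q * (1 + q) * t ^ m"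
    by (simp_all add: c_def s_def t_def algebra_simps power2_eq_square)
  have "(1 - s * s) * (F (2 * Suc m) * W (Suc m)) =
      ((1 - s * s) * (1 + c * c) * F (2 * Suc m)) * W m"
    by (simp add: W mult_ac)
  also have "\<dots> = (1 - s * c) * (F (2 * m) * W m) + (c + s) * (H (2 * m) * W m)"
    unfolding aux(1)[OF 1 2] by (simp add: algebra_simps)
  also have "\<dots> = (1 - s * s) * qbin_conv q (Suc m)"
    unfolding IH cs ss sc qbin_conv_Suc[OF q] by (simp add: t_def)
  finally have "F (2 * Suc m) * W (Suc m) = qbin_conv q (Suc m)"
    using nz by simp
  moreover have "(1 - s * s) * (H (2 * Suc m) * W (Suc m)) =
      ((1 - s * s) * (1 + c * c) * H (2 * Suc m)) * W m"
    by (simp add: W mult_ac)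
  then have "(1 - s * s) * (H (2 * Suc m) * W (Suc m)) =
      (1 + s * c) * (H (2 * m) * W m) + (s - c) * (F (2 * m) * W m)"
    unfolding aux(2)[OF 1 2] by (simp add: algebra_simps)
  then have "(1 - s * s) * (H (2 * Suc m) * W (Suc m)) = (1 - s * s) * qbin_conv (- q) (Suc m)"
    unfolding IH cs ss sc using qbin_conv_Suc[of "- q" m] q by (simp add: t_def power_add)
  then have "H (2 * Suc m) * W (Suc m) = qbin_conv (- q) (Suc m)"
    using nz by simp
  ultimately show ?case by (simp add: F_def H_def W_def)
qed

text \<open>The limit of the closed form along even N. The factors (-q;q^4) and (-q^3;q^4) merge
  into (-q;q^2).\<close>

lemma gf_sign:
  assumes q: "norm q < 1"
  shows "gf (- \<i>) \<i> q = qpochhammer_inf (- q) (q ^ 2) /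
    (qpochhammer_inf (q ^ 4) (q ^ 4) * qpochhammer_inf (- (q ^ 2)) (q ^ 4) ^ 2)"
proof -
  define w where "w = qpochhammer_inf (- (q ^ 2)) (q ^ 4)"
  have p: "norm (q ^ 4) < 1" and t: "norm (- (q ^ 2)) < 1" and q2: "norm (q ^ 2) < 1"
    using norm_power_less_one[OF q, of 4] norm_power_less_one[OF q, of 2] by simp_all
  have w: "w \<noteq> 0"
    unfolding w_def by (rule qpochhammer_inf_nonzero[OF p t])
  have "(\<lambda>m. gf_le (- \<i>) \<i> (2 * m) q) \<longlonglongrightarrow> gf (- \<i>) \<i> q"
    using LIMSEQ_subseq_LIMSEQ[OF gf_le_LIMSEQ[of "- \<i>" \<i> q], of "\<lambda>m. 2 * m"] q
    by (simp add: strict_mono_def o_def)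
  then have "(\<lambda>m. gf_le (- \<i>) \<i> (2 * m) q * qpoch (- (q ^ 2)) (q ^ 4) m) \<longlonglongrightarrow> gf (- \<i>) \<i> q * w"
    unfolding w_def by (intro tendsto_mult qpoch_LIMSEQ p)
  then have "qbin_conv q \<longlonglongrightarrow> gf (- \<i>) \<i> q * w"
    using gf_le_eq_qbin_conv[OF q] by simp
  from LIMSEQ_unique[OF this qbin_conv_LIMSEQ[OF q]]
  have "gf (- \<i>) \<i> q * w = qpochhammer_inf (- q) (q ^ 4) * qpochhammer_inf (- (q ^ 3)) (q ^ 4) /
      (qpochhammer_inf (q ^ 4) (q ^ 4) * w)"
    by (simp add: w_def)
  also have "qpochhammer_inf (- q) (q ^ 4) * qpochhammer_inf (- (q ^ 3)) (q ^ 4) =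
      qpochhammer_inf (- q) (q ^ 2)"
    using qpochhammer_inf_dissect[OF q2, of "- q"]
    by (simp add: power2_eq_square power3_eq_cube power4_eq_xxxx mult_ac)
  finally have "gf (- \<i>) \<i> q = qpochhammer_inf (- q) (q ^ 2) / (qpochhammer_inf (q ^ 4) (q ^ 4) * w) / w"
    by (simp only: nonzero_eq_divide_eq[OF w])
  then show ?thesis
    by (simp add: w_def power2_eq_square mult.assoc)
qed

section \<open>The sign count and the product formula\<close>

lemma sign_odd_parts:
  fixes a b :: nat
  assumes "even a \<longleftrightarrow> even b"
  shows "\<i> ^ a * (- \<i>) ^ b = (if a mod 4 = b mod 4 then 1 else - 1)"
proof -
  have red: "w ^ n = w ^ (n mod 4)" if "w ^ 4 = 1" for w :: complex and n
  proof -
    have "w ^ n = w ^ (4 * (n div 4) + n mod 4)" by simp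
    also have "\<dots> = w ^ (n mod 4)" unfolding power_add power_mult that by simp
    finally show ?thesis .
  qed
  have i4: "\<i> ^ 4 = 1" "(- \<i>) ^ 4 = 1" by (simp_all add: power4_eq_xxxx)
  have "even (a mod 4) \<longleftrightarrow> even (b mod 4)"
    using assms by (simp add: dvd_mod_iff)
  moreover have "a mod 4 \<in> {0, 1, 2, 3}" "b mod 4 \<in> {0, 1, 2, 3}" by auto
  ultimately show ?thesis
    unfolding red[OF i4(1), of a] red[OF i4(2), of b]
    by (auto simp: power2_eq_square power3_eq_cube)
qed

text \<open>Each partition has weight 1 if it is counted by t(n) and -1 otherwise, so the sum is
  t(n) - u(n) = p(n) - 2 u(n).\<close>

lemma sum_weight_eq:
  "sum (weight (- \<i>) \<i>) (partitions n) = of_nat (p_count n) - 2 * of_int (u_count n)"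
proof -
  let ?P = "\<lambda>xs. odd_parts xs mod 4 = odd_parts (conjugate xs) mod 4"
  have fin: "finite (partitions n)" by (rule finite_partitions)
  have "weight (- \<i>) \<i> xs = (if ?P xs then 1 else - 1)" if "xs \<in> partitions n" for xs
  proof -
    have alt: "int (odd_parts (conjugate xs)) = alternating_sum xs"
      using that by (intro odd_parts_conjugate) (simp add: partitions_def)
    then have "even (odd_parts xs) \<longleftrightarrow> even (odd_parts (conjugate xs))"
      using even_odd_parts[of xs] even_alternating_sum[of xs] by (metis even_of_nat)
    moreover have "weight (- \<i>) \<i> xs = \<i> ^ odd_parts xs * (- \<i>) ^ odd_parts (conjugate xs)"
      unfolding weight_def alt[symmetric] by simp
    ultimately show ?thesis by (simp add: sign_odd_parts)
  qed
  then have "sum (weight (- \<i>) \<i>) (partitions n) = (\<Sum>xs\<in>partitions n. if ?P xs then 1 else - 1)"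
    by (intro sum.cong) auto
  also have "\<dots> = of_nat (card {xs \<in> partitions n. ?P xs}) - of_nat (card {xs \<in> partitions n. \<not> ?P xs})"
    using fin by (simp add: sum.If_cases Int_def)
  also have "card {xs \<in> partitions n. ?P xs} = t_count n"
    by (simp add: t_count_def)
  also have "card {xs \<in> partitions n. \<not> ?P xs} = p_count n - t_count n"
  proof -
    have "{xs \<in> partitions n. \<not> ?P xs} = partitions n - {xs \<in> partitions n. ?P xs}" by auto
    then show ?thesis using fin by (simp add: card_Diff_subset p_count_def t_count_def)
  qed
  finally show ?thesis
    using fin by (simp add: u_count_def p_count_def t_count_def card_mono of_nat_diff)
qed

theorem theorem2p1:
  fixes q :: complex
  assumes "norm q < 1"
  shows "(\<lambda>n. of_int (u_count n) * q ^ n) sums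
    (2 * q ^ 2 * (qpochhammer_inf (q ^ 2) (q ^ 2)) ^ 2
        * (qpochhammer_inf (q ^ 8) (q ^ 8)) ^ 2
        * (qpochhammer_inf (q ^ 32) (q ^ 32)) ^ 2
     / (qpochhammer_inf q q
        * (qpochhammer_inf (q ^ 4) (q ^ 4)) ^ 5
        * qpochhammer_inf (q ^ 16) (q ^ 16)))"
proof -
  define P where "P k = qpochhammer_inf (q ^ k) (q ^ k)" for k
  define O' where "O' = qpochhammer_inf (- q) (q ^ 2)"
  define s where "s = qpochhammer_inf q (q ^ 2)"
  define m where "m = qpochhammer_inf (q ^ 2) (q ^ 4)"
  define n where "n = qpochhammer_inf (- (q ^ 2)) (q ^ 4)"
  define r where "r = qpochhammer_inf (q ^ 4) (q ^ 8)"
  have less: "norm (q ^ k) < 1" if "0 < k" for k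
    using assms that by (rule norm_power_less_one)
  have P0: "P k \<noteq> 0" if "0 < k" for k
    unfolding P_def by (intro qpochhammer_inf_nonzero less that)
  have n0: "n \<noteq> 0"
    unfolding n_def by (intro qpochhammer_inf_nonzero) (use less[of 2] less[of 4] in auto)
  have m0: "m \<noteq> 0"
    unfolding m_def by (intro qpochhammer_inf_nonzero less) auto
  have split: "P k = qpochhammer_inf (q ^ k) (q ^ (2 * k)) * P (2 * k)" if "0 < k" for k
    using qpochhammer_inf_dissect[OF less[OF that], of "q ^ k"]
    by (simp add: P_def mult_2 power_add power2_eq_square)
  have P1: "P 1 = s * P 2" and P2: "P 2 = m * P 4" and P4: "P 4 = r * P 8"
    using split[of 1] split[of 2] split[of 4] by (simp_all add: s_def m_def r_def)
  have sO: "s * O' = m"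
    using qpochhammer_inf_plus_minus[OF less[of 2], of q] by (simp add: s_def O'_def m_def)
  have mn: "m * n = r"
    using qpochhammer_inf_plus_minus[OF less[of 4], of "q ^ 2"] by (simp add: m_def n_def r_def)
  \<comment> \<open>The theta difference at x = q^2, where \<open>n\<close> is (-x;x^2) and
    \<open>m\<close> is (x;x^2).\<close>
  have theta: "n ^ 2 * P 4 - m ^ 2 * P 4 = 4 * q ^ 2 * (P 32 ^ 2 / P 16)"
    using theta_difference[OF less[of 2]] by (simp add: m_def n_def P_def flip: power_mult)
  have "(\<lambda>k. (of_nat (p_count k) * q ^ k - sum (weight (- \<i>) \<i>) (partitions k) * q ^ k) / 2) sums
      ((1 / P 1 - O' / (P 4 * n ^ 2)) / 2)"
    using gf_sums[of "- \<i>" \<i> q] assms gf_sign[OF assms]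
    by (intro sums_divide sums_diff) (use p_count_sums[OF assms] in \<open>simp_all add: P_def O'_def n_def\<close>)
  also have "(\<lambda>k. (of_nat (p_count k) * q ^ k - sum (weight (- \<i>) \<i>) (partitions k) * q ^ k) / 2) =
      (\<lambda>k. of_int (u_count k) * q ^ k)"
    by (simp add: sum_weight_eq fun_eq_iff algebra_simps)
  also have "(1 / P 1 - O' / (P 4 * n ^ 2)) / 2 =
      2 * q ^ 2 * P 2 ^ 2 * P 8 ^ 2 * P 32 ^ 2 / (P 1 * P 4 ^ 5 * P 16)"
  proof -
    have nz: "P 1 \<noteq> 0" "P 2 \<noteq> 0" "P 4 \<noteq> 0" "P 8 \<noteq> 0" "P 16 \<noteq> 0" using P0 by auto
    \<comment> \<open>From P 1 = s m P 4 and s O' = m; this makes the numerator over the common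
      denominator a theta difference.\<close>
    have "O' * P 1 = m ^ 2 * P 4"
      unfolding P1 P2 by (simp add: power2_eq_square sO[symmetric] mult_ac)
    then have "1 / P 1 - O' / (P 4 * n ^ 2) = (n ^ 2 * P 4 - m ^ 2 * P 4) / (P 1 * (P 4 * n ^ 2))"
      using nz n0 by (simp add: field_simps)
    also have "\<dots> = 4 * q ^ 2 * P 32 ^ 2 / (P 16 * P 1) * (1 / (n ^ 2 * P 4))"
      unfolding theta by (simp add: mult_ac)
    also have "1 / (n ^ 2 * P 4) = P 2 ^ 2 * P 8 ^ 2 / P 4 ^ 5"
    proof -
      \<comment> \<open>To eliminate \<open>n\<close>, two of the four factors are replaced by P 4 =
        r P 8 with r = m n, and m P 4 is then collected into P 2.\<close>
      have "P 4 ^ 4 = P 4 ^ 2 * (r * P 8) ^ 2"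
        by (simp flip: P4 power_add)
      also have "\<dots> = P 2 ^ 2 * P 8 ^ 2 * n ^ 2"
        by (simp add: P2 mn[symmetric] power_mult_distrib mult_ac)
      finally have "P 4 ^ 5 = P 2 ^ 2 * P 8 ^ 2 * (n ^ 2 * P 4)"
        by (simp add: eval_nat_numeral mult_ac)
      then show ?thesis using n0 nz by (simp add: field_simps)
    qed
    finally show ?thesis by (simp add: mult_ac)
  qed
  finally show ?thesis by (simp add: P_def)
qed

end
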